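(* Let $L>0$, let $a$ satisfy (H_a), and let $\phi$ satisfy (H_φ), $\phi(0)=+\infty$, (H_int), (H_bdd). Then for every $g\in L^2(0,L)$ and every $\delta\in(0,L)$ there exists $\hat g\in L^2(0,L)$ with $\hat g=g$ a.e. on $[0,L-\delta]$ such that problem (P) with data $(a,\hat g,\phi)$ has at least one weak solution.
   Context: (H_a): $a\in L^\infty(0,L)$ and there are constants $0<\alpha<\beta$ with $\alpha\le a(x)\le\beta$ for a.e. $x\in(0,L)$. (H_φ): $\phi:\mathbb{R}\to\mathbb{R}\cup\{+\infty\}$ is continuous when $\mathbb{R}\cup\{+\infty\}$ carries its usual topology, and $\phi(s)<+\infty$ for every $s\neq0$. (H_int): $\int_0^\delta\phi(t)\,dt<+\infty$ and $\int_{-\delta}^0\phi(t)\,dt<+\infty$ for every $\delta\in(0,1)$. (H_bdd): for every $\delta>0$, $\phi$ is bounded (and continuous) on $\mathbb{R}\setminus(-\delta,\delta)$. A weak solution of problem (P) with data $(a,g,\phi)$ is a function $u$ with $u\in H^1_0(0,L)$, $\phi(u)\in L^2(0,L)$, and $-\frac{d}{dx}(a\frac{du}{dx})=-\frac{d\phi(u)}{dx}-\frac{dg}{dx}$ in $\mathcal D'(0,L)$. *)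

theory Defs
  imports "HOL-Analysis.Analysis"
begin

definition L2_on :: "real \<Rightarrow> (real \<Rightarrow> real) \<Rightarrow> bool" where
  "L2_on L f \<longleftrightarrow> set_borel_measurable lborel {0<..<L} f \<and>
     set_integrable lborel {0<..<L} (\<lambda>x. (f x)^2)"

definition test_fun :: "real \<Rightarrow> (real \<Rightarrow> real) \<Rightarrow> bool" where
  "test_fun L \<psi> \<longleftrightarrow> (\<forall>n x. ((deriv ^^ n) \<psi>) differentiable (at x)) \<and>
     (\<exists>c d. 0 < c \<and> c \<le> d \<and> d < L \<and> (\<forall>x. x \<notin> {c..d} \<longrightarrow> \<psi> x = 0))"

text \<open>u belongs to H^1_0(0,L) with weak derivative du: du is in L^2(0,L), and u agrees a.e.
  on (0,L) with the absolutely continuous function x \<mapsto> \<integral>_0^x du, which vanishes at 0 and L.\<close>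
definition H10_deriv :: "real \<Rightarrow> (real \<Rightarrow> real) \<Rightarrow> (real \<Rightarrow> real) \<Rightarrow> bool" where
  "H10_deriv L u du \<longleftrightarrow> L2_on L du \<and>
     (AE x in lborel. x \<in> {0<..<L} \<longrightarrow> u x = (LINT t:{0..x}|lborel. du t)) \<and>
     (LINT t:{0..L}|lborel. du t) = 0"

definition H10 :: "real \<Rightarrow> (real \<Rightarrow> real) \<Rightarrow> bool" where
  "H10 L u \<longleftrightarrow> (\<exists>du. H10_deriv L u du)"

text \<open>Weak solution of (P): -(a u')' = -(phi(u))' - g' in D'(0,L), with u in H^1_0,
  phi(u) in L^2 (in particular phi(u) finite a.e.).\<close>
definition weak_solution ::
  "real \<Rightarrow> (real \<Rightarrow> real) \<Rightarrow> (real \<Rightarrow> real) \<Rightarrow> (real \<Rightarrow> ereal) \<Rightarrow> (real \<Rightarrow> real) \<Rightarrow> bool" where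
  "weak_solution L a g phi u \<longleftrightarrow>
     (\<exists>du. H10_deriv L u du \<and>
        (AE x in lborel. x \<in> {0<..<L} \<longrightarrow> phi (u x) \<noteq> \<infinity>) \<and>
        L2_on L (\<lambda>x. real_of_ereal (phi (u x))) \<and>
        (\<forall>\<psi>. test_fun L \<psi> \<longrightarrow>
           (LINT x:{0<..<L}|lborel. a x * du x * deriv \<psi> x) =
           (LINT x:{0<..<L}|lborel. real_of_ereal (phi (u x)) * deriv \<psi> x) +
           (LINT x:{0<..<L}|lborel. g x * deriv \<psi> x)))"

definition H_a :: "real \<Rightarrow> (real \<Rightarrow> real) \<Rightarrow> bool" where
  "H_a L a \<longleftrightarrow> set_borel_measurable lborel {0<..<L} a \<and>
     (\<exists>\<alpha> \<beta>. 0 < \<alpha> \<and> \<alpha> < \<beta> \<and>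
        (AE x in lborel. x \<in> {0<..<L} \<longrightarrow> \<alpha> \<le> a x \<and> a x \<le> \<beta>))"

definition H_phi :: "(real \<Rightarrow> ereal) \<Rightarrow> bool" where
  "H_phi phi \<longleftrightarrow> (\<forall>s. phi s \<noteq> -\<infinity>) \<and> continuous_on UNIV phi \<and>
     (\<forall>s. s \<noteq> 0 \<longrightarrow> phi s < \<infinity>)"

definition H_int :: "(real \<Rightarrow> ereal) \<Rightarrow> bool" where
  "H_int phi \<longleftrightarrow> (\<forall>\<delta>. 0 < \<delta> \<and> \<delta> < 1 \<longrightarrow>
     set_integrable lborel {0<..<\<delta>} (\<lambda>t. real_of_ereal (phi t)) \<and>
     set_integrable lborel {-\<delta><..<0} (\<lambda>t. real_of_ereal (phi t)))"

definition H_bdd :: "(real \<Rightarrow> ereal) \<Rightarrow> bool" where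
  "H_bdd phi \<longleftrightarrow> (\<forall>\<delta>>0. \<exists>M. \<forall>s. \<bar>s\<bar> \<ge> \<delta> \<longrightarrow>
     phi s \<noteq> \<infinity> \<and> \<bar>real_of_ereal (phi s)\<bar> \<le> M)"

end

(* With T slightly below L, the equation a u' = phi(u) + g, u(0) = 0 is solved on [0, T] with the
   given g: replace phi by its Lipschitz inf-convolutions and test with u'.  Since phi(u) u' is the
   derivative of an antiderivative of phi at u, and phi is integrable near 0 and bounded elsewhere,
   this bounds u' in L^2 uniformly, hence also phi(u) = a u' - g.  Arzela-Ascoli gives a uniform
   limit u; Fatou's lemma shows that phi(u) is in L^2 and that u = 0 only on a null set.
   So u is nonzero at some time beyond L - delta.  From there u is steered to 0 at x = L by a segment
   followed by a time-reversed solution of the same kind of equation, which keeps phi(u) in L^2.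
   On the steering part g is simply redefined as a u' - phi(u). *)
theory Submission
  imports Defs "HOL-Complex_Analysis.Great_Picard"
begin

section \<open>Set integrals over compact intervals\<close>

text \<open>Integrating (P) once gives a u' = phi(u) + g + c with a free constant c; the choice c =
  0 leaves a first-order equation, solved forward in x with coefficient b = 1/a. With c and u(0)
  fixed, no parameter is left to meet u(L) = 0, which is why g is given up near L. The equation is
  singular at its own starting point, since u(0) = 0 is exactly where phi is infinite, and with g
  only in L^2 the trajectory may return to 0 later. So no pointwise bound on phi(u) is at hand, and
  all uniform control comes from the energy. Inf-convolutions suit this because they lie between a
  constant and phi, so that one integrable majorant near 0 serves all of them, and because they
  converge along moving arguments, to +infinity when these tend to 0. The real-valued
  \<open>h\<close> that replaces phi has a junk value at 0; this is harmless only because the zero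
  set of u is null, and that fact is therefore carried along with every path.\<close>

lemma set_integrable_Icc_bounded:
  fixes f :: "real \<Rightarrow> real"
  assumes [measurable]: "f \<in> borel_measurable borel"
    and "\<And>x. x \<in> {c..d} \<Longrightarrow> \<bar>f x\<bar> \<le> C"
  shows "set_integrable lborel {c..d} f"
proof (rule set_integrable_bound[where f="\<lambda>x. C"])
  show "set_integrable lborel {c..d} (\<lambda>x. C)"
    by (rule borel_integrable_compact[THEN iffD2[OF set_integrable_def[THEN meta_eq_to_obj_eq]]]) auto
  show "set_borel_measurable lborel {c..d} f"
    by (simp add: set_borel_measurable_def)
qed (use assms(2) in force)

text \<open>On a bounded interval L^2 lies in L^1; the elementary bound |t| \<le> 1 + t^2 takes the
  place of Cauchy-Schwarz.\<close>

lemma set_integrable_Icc_of_square: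
  fixes f :: "real \<Rightarrow> real"
  assumes [measurable]: "f \<in> borel_measurable borel"
    and "set_integrable lborel {c..d} (\<lambda>x. (f x)\<^sup>2)"
  shows "set_integrable lborel {c..d} f"
proof (rule set_integrable_bound[where f="\<lambda>x. 1 + (f x)\<^sup>2"])
  have "set_integrable lborel {c..d} (\<lambda>x. 1::real)"
    by (rule set_integrable_Icc_bounded[where C=1]) auto
  then show "set_integrable lborel {c..d} (\<lambda>x. 1 + (f x)\<^sup>2)"
    using assms(2) by simp
  show "set_borel_measurable lborel {c..d} f"
    by (simp add: set_borel_measurable_def)
  have "\<bar>t\<bar> \<le> 1 + t\<^sup>2" for t :: real
    using zero_le_power2[of "\<bar>t\<bar> - 1"] abs_ge_zero[of t]
    unfolding power2_diff power2_abs power_one by linarith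
  then show "AE x in lborel. x \<in> {c..d} \<longrightarrow> norm (f x) \<le> norm (1 + (f x)\<^sup>2)"
    by auto
qed

lemma set_integrable_square_add:
  fixes f g :: "real \<Rightarrow> real"
  assumes [measurable]: "f \<in> borel_measurable borel" "g \<in> borel_measurable borel"
      "A \<in> sets borel"
    and "set_integrable lborel A (\<lambda>x. (f x)\<^sup>2)" "set_integrable lborel A (\<lambda>x. (g x)\<^sup>2)"
  shows "set_integrable lborel A (\<lambda>x. (f x + g x)\<^sup>2)"
proof (rule set_integrable_bound[where f="\<lambda>x. 2 * (f x)\<^sup>2 + 2 * (g x)\<^sup>2"])
  show "set_integrable lborel A (\<lambda>x. 2 * (f x)\<^sup>2 + 2 * (g x)\<^sup>2)"
    using assms by simp
  show "set_borel_measurable lborel A (\<lambda>x. (f x + g x)\<^sup>2)"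
    by (simp add: set_borel_measurable_def)
  have "(s + t)\<^sup>2 \<le> 2 * s\<^sup>2 + 2 * t\<^sup>2" for s t :: real
    using zero_le_power2[of "s - t"] by (simp add: power2_diff power2_sum)
  then show "AE x in lborel. x \<in> A \<longrightarrow> norm ((f x + g x)\<^sup>2) \<le> norm (2 * (f x)\<^sup>2 + 2 * (g x)\<^sup>2)"
    by auto
qed

lemma set_integral_Icc_combine:
  fixes f :: "real \<Rightarrow> real"
  assumes "set_integrable lborel {p..r} f" "p \<le> q" "q \<le> r"
  shows "(LINT t:{p..r}|lborel. f t) = (LINT t:{p..q}|lborel. f t) + (LINT t:{q..r}|lborel. f t)"
proof -
  have "{p..r} = {p..q} \<union> {q..r}" using assms by auto
  moreover have "(LINT t:{p..q} \<union> {q..r}|lborel. f t)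
      = (LINT t:{p..q}|lborel. f t) + (LINT t:{q..r}|lborel. f t)"
  proof (rule set_integral_Un_AE)
    show "AE x in lborel. \<not> (x \<in> {p..q} \<and> x \<in> {q..r})"
      using AE_lborel_singleton[of q] by eventually_elim auto
    show "set_integrable lborel {p..q} f" "set_integrable lborel {q..r} f"
      using assms by (auto intro: set_integrable_subset)
  qed auto
  ultimately show ?thesis by simp
qed

lemma continuous_on_indefinite_set_integral:
  fixes f :: "real \<Rightarrow> real"
  assumes "set_integrable lborel {p..q} f"
  shows "continuous_on {p..q} (\<lambda>x. LINT t:{p..x}|lborel. f t)"
proof -
  have "continuous_on {p..q} (\<lambda>x. integral {p..x} f)"
    using set_borel_integral_eq_integral(1)[OF assms] by (rule indefinite_integral_continuous_1)
  moreover have "integral {p..x} f = (LINT t:{p..x}|lborel. f t)" if "x \<in> {p..q}" for x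
    using that by (intro set_borel_integral_eq_integral(2)[symmetric] set_integrable_subset[OF assms]) auto
  ultimately show ?thesis by (rule continuous_on_eq)
qed

lemma abs_set_integral_le:
  fixes f :: "real \<Rightarrow> real"
  assumes "set_integrable lborel A f"
  shows "\<bar>LINT t:A|lborel. f t\<bar> \<le> (LINT t:A|lborel. \<bar>f t\<bar>)"
  using set_integral_norm_bound[OF assms] by simp

lemma set_integral_nonneg:
  fixes f :: "real \<Rightarrow> real"
  assumes "\<And>x. x \<in> A \<Longrightarrow> 0 \<le> f x"
  shows "0 \<le> (LINT t:A|lborel. f t)"
  unfolding set_lebesgue_integral_def
  using assms by (intro Bochner_Integration.integral_nonneg) (auto simp: indicator_def)

lemma set_integral_Icc_const:
  fixes c :: real assumes "p \<le> q"
  shows "(LINT t:{p..q}|lborel. c) = (q - p) * c"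
  using assms by (simp add: set_lebesgue_integral_def)

section \<open>Chain rule for indefinite integrals\<close>

text \<open>The increments of \<open>\<Phi> \<circ> u - \<integral> \<Phi>' (u) u'\<close> over short intervals are controlled by the modulus
  of continuity of \<open>\<Phi>' \<circ> u\<close> times \<open>\<integral> \<bar>u'\<bar>\<close>, and these bounds add up.\<close>
lemma chain_rule_indefinite_integral:
  fixes u du \<Phi> f :: "real \<Rightarrow> real"
  assumes "0 \<le> T" and [measurable]: "du \<in> borel_measurable borel"
    and du: "set_integrable lborel {0..T} du"
    and u: "\<And>x. x \<in> {0..T} \<Longrightarrow> u x = (LINT t:{0..x}|lborel. du t)"
    and cont_u: "continuous_on UNIV u"
    and \<Phi>: "\<And>s. (\<Phi> has_real_derivative f s) (at s)" and cont_f: "continuous_on UNIV f"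
  shows "set_integrable lborel {0..T} (\<lambda>t. f (u t) * du t)"
    and "\<Phi> (u T) - \<Phi> (u 0) = (LINT t:{0..T}|lborel. f (u t) * du t)"
proof -
  have [measurable]: "f \<in> borel_measurable borel" "u \<in> borel_measurable borel"
    using cont_f cont_u by (auto intro: borel_measurable_continuous_onI)
  have cont_fu: "continuous_on A (\<lambda>t. f (u t))" for A
    by (rule continuous_on_compose2[OF cont_f]) (auto intro: continuous_on_subset[OF cont_u])
  obtain B where B: "\<And>t. t \<in> {0..T} \<Longrightarrow> \<bar>f (u t)\<bar> \<le> B"
    using compact_imp_bounded[OF compact_continuous_image[OF cont_fu compact_Icc], of 0 T]
    unfolding bounded_iff by (metis imageI real_norm_def)
  have dua: "set_integrable lborel {0..T} (\<lambda>t. \<bar>du t\<bar>)"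
    using du by (rule set_integrable_abs)
  show int: "set_integrable lborel {0..T} (\<lambda>t. f (u t) * du t)"
  proof (rule set_integrable_bound[where f="\<lambda>t. B * \<bar>du t\<bar>"])
    show "set_integrable lborel {0..T} (\<lambda>t. B * \<bar>du t\<bar>)" using dua by simp
    show "set_borel_measurable lborel {0..T} (\<lambda>t. f (u t) * du t)"
      by (simp add: set_borel_measurable_def)
    show "AE x in lborel. x \<in> {0..T} \<longrightarrow> norm (f (u x) * du x) \<le> norm (B * \<bar>du x\<bar>)"
      using B by (fastforce simp: abs_mult intro!: mult_right_mono AE_I2)
  qed
  define R where "R x y = \<Phi> (u y) - \<Phi> (u x) - (LINT t:{x..y}|lborel. f (u t) * du t)" for x y
  define V where "V x y = (LINT t:{x..y}|lborel. \<bar>du t\<bar>)" for x y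
  have sub: "set_integrable lborel {x..y} f" if "set_integrable lborel {0..T} f" "0 \<le> x" "y \<le> T"
    for x y and f :: "real \<Rightarrow> real"
    using that by (auto intro: set_integrable_subset)
  have Rsplit: "R x z = R x y + R y z" and Vsplit: "V x z = V x y + V y z"
    if "0 \<le> x" "x \<le> y" "y \<le> z" "z \<le> T" for x y z
    unfolding R_def V_def
    using set_integral_Icc_combine[OF sub[OF int], of x z y]
      set_integral_Icc_combine[OF sub[OF dua], of x z y] that by simp_all
  have small: "\<bar>R 0 T\<bar> \<le> e * V 0 T" if "e > 0" for e
  proof -
    have "uniformly_continuous_on {0..T} (\<lambda>t. f (u t))"
      using cont_fu by (intro compact_uniformly_continuous) auto
    then obtain d where "d > 0" and
      d: "\<And>s t. s \<in> {0..T} \<Longrightarrow> t \<in> {0..T} \<Longrightarrow> dist t s < d \<Longrightarrow> dist (f (u t)) (f (u s)) < e"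
      using \<open>e > 0\<close> unfolding uniformly_continuous_on_def by metis
    have step: "\<bar>R x y\<bar> \<le> e * V x y" if xy: "0 \<le> x" "x \<le> y" "y \<le> T" "y - x < d" for x y
    proof -
      \<comment> \<open>The mean value theorem for \<Phi> gives a point between \<open>u x\<close>
        and \<open>u y\<close>; continuity of \<open>u\<close> realizes it as \<open>u \<xi>\<close>
        with \<xi> in the same short interval. So \<open>f (u \<xi>)\<close> can be compared with
        \<open>f (u t)\<close> through the modulus \<open>d\<close>.\<close>
      obtain \<xi> where \<xi>: "\<xi> \<in> {x..y}" "\<Phi> (u y) - \<Phi> (u x) = f (u \<xi>) * (u y - u x)"
      proof (cases "u x = u y")
        case True
        then show ?thesis using that[of x] xy by simp
      next
        case False
        have "\<exists>z. z \<in> closed_segment (u x) (u y) \<and> \<Phi> (u y) - \<Phi> (u x) = f z * (u y - u x)"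
        proof (cases "u x < u y")
          case True
          then obtain z where "u x < z" "z < u y" "\<Phi> (u y) - \<Phi> (u x) = (u y - u x) * f z"
            using MVT2[OF True, of \<Phi> f] \<Phi> by blast
          then show ?thesis by (intro exI[of _ z]) (auto simp: closed_segment_eq_real_ivl)
        next
          case False
          then have lt: "u y < u x" using \<open>u x \<noteq> u y\<close> by simp
          then obtain z where "u y < z" "z < u x" "\<Phi> (u x) - \<Phi> (u y) = (u x - u y) * f z"
            using MVT2[OF lt, of \<Phi> f] \<Phi> by blast
          then show ?thesis
            by (intro exI[of _ z]) (auto simp: closed_segment_eq_real_ivl algebra_simps)
        qed
        then obtain z where z: "z \<in> closed_segment (u x) (u y)"
          "\<Phi> (u y) - \<Phi> (u x) = f z * (u y - u x)" by blast
        have "closed_segment (u x) (u y) \<subseteq> u ` {x..y}"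
        proof -
          have "connected (u ` {x..y})"
            by (rule connected_continuous_image) (auto intro: continuous_on_subset[OF cont_u])
          then have "convex (u ` {x..y})" using is_interval_connected_1 is_interval_convex_1 by blast
          then show ?thesis using xy by (intro closed_segment_subset) auto
        qed
        then show ?thesis using z that by blast
      qed
      have "u y - u x = (LINT t:{x..y}|lborel. du t)"
        using u[of x] u[of y] set_integral_Icc_combine[OF sub[OF du], of 0 y x] xy by simp
      then have "R x y = (LINT t:{x..y}|lborel. f (u \<xi>) * du t) - (LINT t:{x..y}|lborel. f (u t) * du t)"
        unfolding R_def \<xi>(2) by simp
      also have "\<dots> = (LINT t:{x..y}|lborel. f (u \<xi>) * du t - f (u t) * du t)"
        using sub[OF du] sub[OF int] xy by (intro set_integral_diff(2)[symmetric]) auto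
      finally have "\<bar>R x y\<bar> \<le> (LINT t:{x..y}|lborel. \<bar>f (u \<xi>) * du t - f (u t) * du t\<bar>)"
        using sub[OF du] sub[OF int] xy
        by (simp only:) (intro abs_set_integral_le set_integral_diff(1) set_integrable_mult_right; simp)
      also have "\<dots> \<le> (LINT t:{x..y}|lborel. e * \<bar>du t\<bar>)"
      proof (rule set_integral_mono)
        show "set_integrable lborel {x..y} (\<lambda>t. \<bar>f (u \<xi>) * du t - f (u t) * du t\<bar>)"
          using sub[OF du] sub[OF int] xy by (intro set_integrable_abs set_integral_diff(1)) auto
        show "set_integrable lborel {x..y} (\<lambda>t. e * \<bar>du t\<bar>)"
          using sub[OF dua] xy by simp
        fix t assume "t \<in> {x..y}"
        then have "\<bar>f (u \<xi>) - f (u t)\<bar> \<le> e"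
          using d[of t \<xi>] \<xi>(1) xy by (force simp: dist_real_def)
        then show "\<bar>f (u \<xi>) * du t - f (u t) * du t\<bar> \<le> e * \<bar>du t\<bar>"
          by (metis abs_ge_zero abs_mult left_diff_distrib mult_right_mono)
      qed
      finally show ?thesis unfolding V_def by simp
    qed
    \<comment> \<open>Induction over the number of pieces of length d/2; half of \<open>d\<close>
      because \<open>step\<close> needs a length strictly below \<open>d\<close>.\<close>
    have "\<bar>R 0 x\<bar> \<le> e * V 0 x" if "x \<in> {0..T}" "x \<le> real n * (d / 2)" for n x
      using that
    proof (induction n arbitrary: x)
      case 0
      then show ?case using step[of 0 x] \<open>d > 0\<close> by simp
    next
      case (Suc n)
      define y where "y = max 0 (x - d / 2)"
      have y: "0 \<le> y" "y \<le> x" "x \<le> T" "x - y < d" "y \<le> real n * (d / 2)"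
        using Suc.prems \<open>d > 0\<close> by (auto simp: y_def algebra_simps max_def)
      have "\<bar>R 0 y\<bar> \<le> e * V 0 y" using Suc.IH[of y] y by auto
      moreover have "\<bar>R y x\<bar> \<le> e * V y x" using step y by auto
      ultimately show ?case
        using Rsplit[of 0 y x] Vsplit[of 0 y x] y by (auto simp: algebra_simps)
    qed
    moreover obtain n where "T \<le> real n * (d / 2)"
      using reals_Archimedean3[of "d / 2"] \<open>d > 0\<close> by (meson half_gt_zero less_eq_real_def)
    ultimately show ?thesis using \<open>0 \<le> T\<close> by auto
  qed
  have "V 0 T \<ge> 0" unfolding V_def by (intro set_integral_nonneg) auto
  have "\<bar>R 0 T\<bar> \<le> 0"
  proof (rule field_le_epsilon)
    fix e :: real assume "e > 0"
    \<comment> \<open>The summand 1 covers the case \<open>V 0 T = 0\<close>.\<close>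
    have "\<bar>R 0 T\<bar> \<le> e / (V 0 T + 1) * V 0 T"
      using \<open>e > 0\<close> \<open>V 0 T \<ge> 0\<close> by (intro small) auto
    also have "\<dots> \<le> e" using \<open>e > 0\<close> \<open>V 0 T \<ge> 0\<close> by (simp add: divide_simps)
    finally show "\<bar>R 0 T\<bar> \<le> 0 + e" by simp
  qed
  then show "\<Phi> (u T) - \<Phi> (u 0) = (LINT t:{0..T}|lborel. f (u t) * du t)"
    by (simp add: R_def)
qed

text \<open>The integrable part of the bound contributes at most the total mass of \<open>k\<close>
  to any increment, the constant part at most M times the length. Hence the bound on \<Phi> does not
  see how large \<open>f\<close> is near 0 and is the same for all regularizations. The point 0 is
  exempt because the growth bound of the regularizations does not cover it; a single point does not
  affect the integrals.\<close>

lemma antiderivative_linear_bound: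
  fixes f k :: "real \<Rightarrow> real"
  assumes f: "continuous_on UNIV f" and k: "integrable lborel k" "\<And>s. 0 \<le> k s"
    and M: "\<And>s. s \<noteq> 0 \<Longrightarrow> \<bar>f s\<bar> \<le> k s + M"
  obtains \<Phi> where "\<And>s. (\<Phi> has_real_derivative f s) (at s)"
    "\<Phi> 0 = 0" "\<And>s. \<bar>\<Phi> s\<bar> \<le> (LINT t|lborel. k t) + M * \<bar>s\<bar>"
proof -
  obtain F where F: "\<And>s. (F has_vector_derivative f s) (at s)"
    using einterval_antiderivative[of "-\<infinity>" \<infinity> f] f
    by (auto simp: continuous_on_eq_continuous_at)
  have [measurable]: "f \<in> borel_measurable borel"
    using f by (rule borel_measurable_continuous_onI)
  have incr: "\<bar>F q - F p\<bar> \<le> (LINT t|lborel. k t) + M * (q - p)" if "p \<le> q" for p q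
  proof -
    have fi: "set_integrable lborel {p..q} f"
      unfolding set_integrable_def using borel_integrable_compact[OF compact_Icc continuous_on_subset[OF f]] by auto
    have ki: "set_integrable lborel {p..q} k"
      unfolding set_integrable_def using k(1) by (intro integrable_mult_indicator) auto
    have ci: "set_integrable lborel {p..q} (\<lambda>t. M)"
      by (rule set_integrable_Icc_bounded[where C="\<bar>M\<bar>"]) auto
    have "F q - F p = (LINT t:{p..q}|lborel. f t)"
      unfolding set_lebesgue_integral_def
      by (rule integral_FTC_atLeastAtMost[symmetric])
        (use that F f in \<open>auto intro: has_vector_derivative_at_within continuous_on_subset\<close>)
    then have "\<bar>F q - F p\<bar> \<le> (LINT t:{p..q}|lborel. \<bar>f t\<bar>)"
      using abs_set_integral_le[OF fi] by simp
    also have "\<dots> \<le> (LINT t:{p..q}|lborel. k t + M)"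
    proof (rule set_integral_mono_AE)
      show "set_integrable lborel {p..q} (\<lambda>t. k t + M)" using ki ci by simp
      show "AE t\<in>{p..q} in lborel. \<bar>f t\<bar> \<le> k t + M"
        using AE_lborel_singleton[of 0] by eventually_elim (use M in auto)
    qed (use fi in \<open>rule set_integrable_abs\<close>)
    also have "\<dots> = (LINT t:{p..q}|lborel. k t) + (q - p) * M"
      using ki ci that by (simp add: set_integral_Icc_const)
    also have "(LINT t:{p..q}|lborel. k t) \<le> (LINT t|lborel. k t)"
      unfolding set_lebesgue_integral_def
      using k by (intro integral_mono integrable_mult_indicator) (auto simp: indicator_def)
    finally show ?thesis by (simp add: mult.commute)
  qed
  show thesis
  proof (rule that[of "\<lambda>s. F s - F 0"])
    show "((\<lambda>s. F s - F 0) has_real_derivative f s) (at s)" for s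
      using F by (auto intro!: derivative_eq_intros simp: has_real_derivative_iff_has_vector_derivative)
    show "\<bar>F s - F 0\<bar> \<le> (LINT t|lborel. k t) + M * \<bar>s\<bar>" for s
      using incr[of 0 s] incr[of s 0] by (cases "s \<ge> 0") (auto simp: abs_minus_commute)
  qed simp
qed

section \<open>Lipschitz integral equations\<close>

text \<open>Banach's fixed point theorem for \<open>v(x) = exp (- K x) u(x)\<close>; the weight turns
  the integral operator into a contraction on the whole interval.\<close>
lemma lipschitz_integral_equation:
  fixes f b q :: "real \<Rightarrow> real"
  assumes "0 < T" and lip: "\<And>s t. \<bar>f s - f t\<bar> \<le> \<Lambda> * \<bar>s - t\<bar>"
    and [measurable]: "b \<in> borel_measurable borel" "q \<in> borel_measurable borel"
    and b: "\<And>t. \<bar>b t\<bar> \<le> B" and q: "set_integrable lborel {0..T} q"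
  obtains u where "continuous_on UNIV u"
    "\<And>x. x \<in> {0..T} \<Longrightarrow> u x = (LINT t:{0..x}|lborel. b t * f (u t) + q t)"
proof -
  define \<Lambda>' where "\<Lambda>' = \<bar>\<Lambda>\<bar> + 1"
  define B' where "B' = \<bar>B\<bar> + 1"
  \<comment> \<open>Integrating B' \<Lambda>' exp (K t) up to z gives less than (B' \<Lambda>' / K)
    exp (K z), so this K yields the contraction factor 1/2. The summands 1 in \<open>B'\<close> and
    \<open>\<Lambda>'\<close> keep K positive.\<close>
  define K where "K = 2 * B' * \<Lambda>'"
  have pos: "\<Lambda>' > 0" "B' > 0" "K > 0" by (auto simp: \<Lambda>'_def B'_def K_def)
  have lip': "\<bar>f s - f t\<bar> \<le> \<Lambda>' * \<bar>s - t\<bar>" for s t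
  proof -
    have "\<Lambda> * \<bar>s - t\<bar> \<le> \<Lambda>' * \<bar>s - t\<bar>" by (rule mult_right_mono) (auto simp: \<Lambda>'_def)
    then show ?thesis using lip[of s t] by linarith
  qed
  have b': "\<bar>b t\<bar> \<le> B'" for t using b[of t] by (simp add: B'_def)
  have cont_f: "continuous_on UNIV f"
  proof (rule uniformly_continuous_imp_continuous, rule lipschitz_on_uniformly_continuous)
    show "\<Lambda>'-lipschitz_on UNIV f"
      using lip' pos by (intro lipschitz_onI) (auto simp: dist_real_def)
  qed
  \<comment> \<open>Clamping to [0, T] makes the integral operator act on bounded continuous
    functions on the whole line, a complete space that exists as a type.\<close>
  define c where "c x = max 0 (min T x)" for x :: real
  have c: "c x \<in> {0..T}" for x using \<open>0 < T\<close> by (auto simp: c_def)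
  have cont_c: "continuous_on UNIV c" unfolding c_def by (intro continuous_intros)
  define w where "w v t = f (exp (K * t) * v t)" for v t
  define D where "D v t = b t * w v t + q t" for v t
  define S where "S v x = exp (- K * c x) * (LINT t:{0..c x}|lborel. D v t)" for v x
  have cont_w: "continuous_on UNIV (w v)" if "continuous_on UNIV v" for v
    unfolding w_def using that by (intro continuous_on_compose2[OF cont_f] continuous_intros) auto
  have [measurable]: "w v \<in> borel_measurable borel" if "continuous_on UNIV v" for v
    using cont_w[OF that] by (rule borel_measurable_continuous_onI)
  have bw: "set_integrable lborel {0..T} (\<lambda>t. b t * w v t)" if v: "continuous_on UNIV v" for v
  proof -
    obtain C where C: "\<And>t. t \<in> {0..T} \<Longrightarrow> \<bar>w v t\<bar> \<le> C"
      using compact_imp_bounded[OF compact_continuous_image[OF continuous_on_subset[OF cont_w[OF v]] compact_Icc], of 0 T]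
      unfolding bounded_iff by (metis imageI real_norm_def subset_UNIV)
    have [measurable]: "w v \<in> borel_measurable borel"
      using cont_w[OF v] by (rule borel_measurable_continuous_onI)
    show ?thesis
    proof (rule set_integrable_Icc_bounded[where C="B' * C"])
      show "(\<lambda>t. b t * w v t) \<in> borel_measurable borel" by measurable
      fix t assume t: "t \<in> {0..T}"
      show "\<bar>b t * w v t\<bar> \<le> B' * C"
        unfolding abs_mult using b'[of t] C[OF t] pos by (intro mult_mono) auto
    qed
  qed
  have D: "set_integrable lborel {0..T} (D v)" if v: "continuous_on UNIV v" for v
    unfolding D_def using bw[OF v] q by simp
  have S: "S v \<in> bcontfun" if v: "continuous_on UNIV v" for v
  proof -
    have contI: "continuous_on {0..T} (\<lambda>x. exp (- K * x) * (LINT t:{0..x}|lborel. D v t))"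
      using D[OF v] by (intro continuous_intros continuous_on_indefinite_set_integral)
    then have "continuous_on UNIV (S v)"
      unfolding S_def using c by (intro continuous_on_compose2[OF contI cont_c]) auto
    moreover have "bounded (range (S v))"
    proof (rule bounded_subset)
      show "bounded ((\<lambda>x. exp (- K * x) * (LINT t:{0..x}|lborel. D v t)) ` {0..T})"
        by (intro compact_imp_bounded compact_continuous_image contI) auto
      show "range (S v) \<subseteq> (\<lambda>x. exp (- K * x) * (LINT t:{0..x}|lborel. D v t)) ` {0..T}"
        unfolding S_def using c by auto
    qed
    ultimately show ?thesis by (simp add: bcontfun_def)
  qed
  define F where "F v = Bcontfun (S (apply_bcontfun v))" for v
  have F: "apply_bcontfun (F v) = S (apply_bcontfun v)" for v
    unfolding F_def using S by (simp add: Bcontfun_inverse)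
  have contr: "dist (F v1) (F v2) \<le> 1/2 * dist v1 v2" for v1 v2
  proof (rule dist_bound)
    fix x
    define z where "z = c x"
    define d where "d = dist v1 v2"
    have z: "0 \<le> z" "z \<le> T" using c[of x] by (auto simp: z_def)
    have Dz: "set_integrable lborel {0..z} (D (apply_bcontfun v))" for v
      by (rule set_integrable_subset[OF D]) (use z in auto)
    have E: "(\<lambda>t. B' * \<Lambda>' * d * exp (K * t)) = (\<lambda>t. K * exp (K * t) * (d / 2))"
      by (auto simp: K_def)
    have E_int: "set_integrable lborel {0..z} (\<lambda>t. K * exp (K * t))"
      unfolding set_integrable_def
      by (rule borel_integrable_compact) (auto intro!: continuous_intros)
    have E_val: "(LINT t:{0..z}|lborel. K * exp (K * t)) = exp (K * z) - exp (K * 0)"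
      unfolding set_lebesgue_integral_def
      by (rule integral_FTC_atLeastAtMost[OF z(1)])
        (auto intro!: derivative_eq_intros continuous_intros simp: has_real_derivative_iff_has_vector_derivative[symmetric])
    have "\<bar>(LINT t:{0..z}|lborel. D v1 t) - (LINT t:{0..z}|lborel. D v2 t)\<bar>
        = \<bar>LINT t:{0..z}|lborel. D v1 t - D v2 t\<bar>"
      using Dz by simp
    also have "\<dots> \<le> (LINT t:{0..z}|lborel. \<bar>D v1 t - D v2 t\<bar>)"
      using Dz by (intro abs_set_integral_le) auto
    also have "\<dots> \<le> (LINT t:{0..z}|lborel. K * exp (K * t) * (d / 2))"
    proof (rule set_integral_mono)
      show "set_integrable lborel {0..z} (\<lambda>t. \<bar>D v1 t - D v2 t\<bar>)"
        using Dz by (intro set_integrable_abs) auto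
      show "set_integrable lborel {0..z} (\<lambda>t. K * exp (K * t) * (d / 2))"
        using E_int by (rule set_integrable_mult_left)
      fix t
      have "\<bar>D v1 t - D v2 t\<bar> = \<bar>b t\<bar> * \<bar>w v1 t - w v2 t\<bar>"
        by (simp add: D_def abs_mult[symmetric] algebra_simps)
      also have "\<dots> \<le> B' * (\<Lambda>' * (exp (K * t) * d))"
      proof (rule mult_mono)
        have "\<bar>w v1 t - w v2 t\<bar> \<le> \<Lambda>' * \<bar>exp (K * t) * v1 t - exp (K * t) * v2 t\<bar>"
          unfolding w_def by (rule lip')
        also have "\<bar>exp (K * t) * v1 t - exp (K * t) * v2 t\<bar> = exp (K * t) * \<bar>v1 t - v2 t\<bar>"
          by (simp add: right_diff_distrib[symmetric] abs_mult)
        also have "\<bar>v1 t - v2 t\<bar> \<le> d"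
          unfolding d_def using dist_bounded[of v1 t v2] by (simp add: dist_real_def)
        finally show "\<bar>w v1 t - w v2 t\<bar> \<le> \<Lambda>' * (exp (K * t) * d)"
          using pos by simp
      qed (use b' pos in auto)
      also have "\<dots> = K * exp (K * t) * (d / 2)" by (simp add: K_def)
      finally show "\<bar>D v1 t - D v2 t\<bar> \<le> K * exp (K * t) * (d / 2)" .
    qed
    also have "\<dots> = (exp (K * z) - 1) * (d / 2)"
      by (simp only: set_integral_mult_left E_val) simp
    also have "\<dots> \<le> exp (K * z) * (d / 2)"
      by (intro mult_right_mono) (auto simp: d_def)
    finally have "exp (- K * z) * \<bar>(LINT t:{0..z}|lborel. D v1 t) - (LINT t:{0..z}|lborel. D v2 t)\<bar>
      \<le> exp (- K * z) * (exp (K * z) * (d / 2))" by (intro mult_left_mono) auto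
    then show "dist (apply_bcontfun (F v1) x) (apply_bcontfun (F v2) x) \<le> 1/2 * dist v1 v2"
      unfolding F S_def z_def[symmetric] d_def[symmetric]
      by (simp add: dist_real_def right_diff_distrib[symmetric] abs_mult mult.assoc[symmetric] exp_add[symmetric])
  qed
  then obtain v where v: "F v = v"
    using banach_fix_type[of "1/2" F] by auto
  define u where "u x = exp (K * x) * apply_bcontfun v x" for x
  show thesis
  proof (rule that)
    show "continuous_on UNIV u" unfolding u_def by (intro continuous_intros) auto
    fix x assume "x \<in> {0..T}"
    then have "c x = x" by (auto simp: c_def)
    have "apply_bcontfun v x = S (apply_bcontfun v) x" using F[of v] v by simp
    then show "u x = (LINT t:{0..x}|lborel. b t * f (u t) + q t)"
      unfolding u_def S_def \<open>c x = x\<close> D_def w_def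
      by (simp add: mult.assoc[symmetric] exp_add[symmetric])
  qed
qed

section \<open>Lipschitz regularization\<close>

text \<open>The infimum omits \<open>t = 0\<close>, where \<open>h\<close> will carry a junk value in place of \<open>\<infinity>\<close>.\<close>
definition inf_convolution :: "nat \<Rightarrow> (real \<Rightarrow> real) \<Rightarrow> real \<Rightarrow> real" where
  "inf_convolution n h s = (INF t\<in>-{0}. h t + real n * \<bar>s - t\<bar>)"

lemma inf_convolution_bdd_below:
  assumes "\<And>t. - m \<le> h t"
  shows "bdd_below ((\<lambda>t. h t + real n * \<bar>s - t\<bar>) ` A)"
  using assms by (intro bdd_belowI2[where m="- m"]) (simp add: add_increasing2)

lemma inf_convolution_le:
  assumes "\<And>t. - m \<le> h t" "s \<noteq> 0"
  shows "inf_convolution n h s \<le> h s"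
  unfolding inf_convolution_def
  using cINF_lower[OF inf_convolution_bdd_below[of m h n s "-{0}"], of s] assms by simp

lemma inf_convolution_ge:
  assumes "\<And>t. t \<noteq> 0 \<Longrightarrow> C \<le> h t + real n * \<bar>s - t\<bar>"
  shows "C \<le> inf_convolution n h s"
  unfolding inf_convolution_def using assms
  by (intro cINF_greatest) (auto intro: exI[of _ "1::real"])

text \<open>An infimum of functions of \<open>s\<close> that are all Lipschitz with constant
  \<open>n\<close> keeps this constant; the lower bound on \<open>h\<close> makes the infimum
  finite.\<close>

lemma inf_convolution_lipschitz:
  assumes "\<And>t. - m \<le> h t"
  shows "\<bar>inf_convolution n h s - inf_convolution n h s'\<bar> \<le> real n * \<bar>s - s'\<bar>"
proof -
  have "inf_convolution n h p - real n * \<bar>p - p'\<bar> \<le> inf_convolution n h p'" for p p'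
  proof (rule inf_convolution_ge)
    fix t :: real assume "t \<noteq> 0"
    then have "inf_convolution n h p \<le> h t + real n * \<bar>p - t\<bar>"
      unfolding inf_convolution_def
      using cINF_lower[OF inf_convolution_bdd_below[of m h n p "-{0}"], of t] assms by simp
    moreover have "real n * \<bar>p - t\<bar> \<le> real n * (\<bar>p - p'\<bar> + \<bar>p' - t\<bar>)"
      by (intro mult_left_mono) auto
    ultimately show "inf_convolution n h p - real n * \<bar>p - p'\<bar> \<le> h t + real n * \<bar>p' - t\<bar>"
      by (simp add: algebra_simps)
  qed
  from this[of s s'] this[of s' s] show ?thesis by (simp add: abs_minus_commute)
qed

text \<open>Points t near the limit \<open>s\<close> have \<open>h t\<close> at least C, and all
  others pay a penalty of at least \<open>k n\<close> times r/2, which eventually outweighs the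
  lower bound -m. Arguments and indices move together because the lemma is applied to a subsequence
  of approximate solutions. The condition \<open>at\<close> is void for s = 0, so finite limits and
  blow-up are both covered.\<close>

lemma inf_convolution_eventually_ge:
  assumes low: "\<And>t. - m \<le> h t" and s: "\<sigma> \<longlonglongrightarrow> s" and k: "strict_mono (k :: nat \<Rightarrow> nat)"
    and near: "\<forall>\<^sub>F t in at s. C \<le> h t" and at: "s \<noteq> 0 \<Longrightarrow> C \<le> h s"
  shows "\<forall>\<^sub>F n in sequentially. C \<le> inf_convolution (k n) h (\<sigma> n)"
proof -
  obtain r where "r > 0" and r: "\<And>t. t \<noteq> 0 \<Longrightarrow> \<bar>t - s\<bar> < r \<Longrightarrow> C \<le> h t"
    using near at unfolding eventually_at dist_real_def by (metis UNIV_I)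
  obtain N where N: "\<bar>C\<bar> + \<bar>m\<bar> \<le> real N * (r / 2)"
    using reals_Archimedean3[of "r / 2"] \<open>r > 0\<close> by (meson half_gt_zero less_eq_real_def)
  have "\<forall>\<^sub>F n in sequentially. \<bar>\<sigma> n - s\<bar> < r / 2"
    using tendstoD[OF s, of "r / 2"] \<open>r > 0\<close> by (simp add: dist_real_def)
  moreover have "\<forall>\<^sub>F n in sequentially. N \<le> k n"
    using eventually_ge_at_top[of N] by eventually_elim (use seq_suble[OF k] in \<open>meson le_trans\<close>)
  ultimately show ?thesis
  proof eventually_elim
    case (elim n)
    show ?case
    proof (rule inf_convolution_ge)
      fix t :: real assume "t \<noteq> 0"
      show "C \<le> h t + real (k n) * \<bar>\<sigma> n - t\<bar>"
      proof (cases "\<bar>t - s\<bar> < r")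
        case True
        then have "C \<le> h t" using r \<open>t \<noteq> 0\<close> by blast
        then show ?thesis by (simp add: add_increasing2)
      next
        case False
        then have "r / 2 \<le> \<bar>\<sigma> n - t\<bar>" using elim by linarith
        then have "real N * (r / 2) \<le> real (k n) * \<bar>\<sigma> n - t\<bar>"
          using elim \<open>r > 0\<close> by (intro mult_mono) auto
        then show ?thesis using N low[of t] by linarith
      qed
    qed
  qed
qed

section \<open>Limits of integrals under an \<open>L\<^sup>2\<close> bound\<close>

text \<open>Split \<open>\<bar>F n - f\<bar> \<le> min \<bar>F n - f\<bar> K + (F n - f)\<^sup>2 / K\<close>: the first part is handled by dominated
  convergence, the second is \<open>O(1/K)\<close> uniformly in \<open>n\<close>.\<close>
lemma tendsto_set_integral_of_L2_bounded:
  fixes F :: "nat \<Rightarrow> real \<Rightarrow> real"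
  assumes [measurable]: "\<And>n. F n \<in> borel_measurable borel" "f \<in> borel_measurable borel"
    and conv: "AE x in lborel. x \<in> {p..q} \<longrightarrow> (\<lambda>n. F n x) \<longlonglongrightarrow> f x"
    and int: "\<And>n. set_integrable lborel {p..q} (\<lambda>x. (F n x)\<^sup>2)"
    and C: "\<And>n. (LINT x:{p..q}|lborel. (F n x)\<^sup>2) \<le> C"
    and f: "set_integrable lborel {p..q} (\<lambda>x. (f x)\<^sup>2)"
  shows "(\<lambda>n. LINT x:{p..q}|lborel. F n x) \<longlonglongrightarrow> (LINT x:{p..q}|lborel. f x)"
proof -
  let ?I = "{p..q}"
  define G where "G n x = F n x - f x" for n x
  have [measurable]: "G n \<in> borel_measurable borel" for n
    unfolding G_def by measurable
  have G2: "set_integrable lborel ?I (\<lambda>x. (G n x)\<^sup>2)" for n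
    using set_integrable_square_add[of "F n" "\<lambda>x. - f x" ?I] int f by (simp add: G_def)
  have Gi: "set_integrable lborel ?I (G n)" for n
    by (rule set_integrable_Icc_of_square[OF _ G2]) simp
  define C' where "C' = 2 * C + 2 * (LINT x:?I|lborel. (f x)\<^sup>2)"
  have C': "(LINT x:?I|lborel. (G n x)\<^sup>2) \<le> C'" for n
  proof -
    have "(LINT x:?I|lborel. (G n x)\<^sup>2) \<le> (LINT x:?I|lborel. 2 * (F n x)\<^sup>2 + 2 * (f x)\<^sup>2)"
    proof (rule set_integral_mono[OF G2])
      show "set_integrable lborel ?I (\<lambda>x. 2 * (F n x)\<^sup>2 + 2 * (f x)\<^sup>2)" using int f by simp
      show "(G n x)\<^sup>2 \<le> 2 * (F n x)\<^sup>2 + 2 * (f x)\<^sup>2" for x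
        using zero_le_power2[of "F n x + f x"] by (simp add: G_def power2_diff power2_sum)
    qed
    also have "\<dots> = 2 * (LINT x:?I|lborel. (F n x)\<^sup>2) + 2 * (LINT x:?I|lborel. (f x)\<^sup>2)"
      using int f by simp
    finally show ?thesis using C[of n] by (simp add: C'_def)
  qed
  have "C' \<ge> 0" using C'[of 0] by (rule order_trans[rotated]) (intro set_integral_nonneg, auto)
  have lim0: "(\<lambda>n. LINT x:?I|lborel. min \<bar>G n x\<bar> K) \<longlonglongrightarrow> 0" if "K > 0" for K
  proof -
    have "(\<lambda>n. LINT x|lborel. indicator ?I x *\<^sub>R min \<bar>G n x\<bar> K) \<longlonglongrightarrow> integral\<^sup>L lborel (\<lambda>x::real. 0::real)"
    proof (rule integral_dominated_convergence[where w="\<lambda>x. indicator ?I x *\<^sub>R K"])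
      show "integrable lborel (\<lambda>x. indicator ?I x *\<^sub>R K)"
        using set_integrable_Icc_bounded[of "\<lambda>x. K" p q K] that by (simp add: set_integrable_def)
      show "AE x in lborel. (\<lambda>n. indicator ?I x *\<^sub>R min \<bar>G n x\<bar> K) \<longlonglongrightarrow> 0"
        using conv
      proof eventually_elim
        case (elim x)
        show ?case
        proof (cases "x \<in> ?I")
          case True
          then have "(\<lambda>n. G n x) \<longlonglongrightarrow> 0"
            using elim unfolding G_def by (simp add: LIM_zero)
          then have "(\<lambda>n. min \<bar>G n x\<bar> K) \<longlonglongrightarrow> min \<bar>0\<bar> K" by (intro tendsto_intros)
          then show ?thesis using that True by simp
        qed simp
      qed
      show "AE x in lborel. norm (indicator ?I x *\<^sub>R min \<bar>G n x\<bar> K) \<le> indicator ?I x *\<^sub>R K" for n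
        using that by (auto simp: indicator_def)
    qed auto
    then show ?thesis by (simp add: set_lebesgue_integral_def)
  qed
  have "(\<lambda>n. LINT x:?I|lborel. G n x) \<longlonglongrightarrow> 0"
  proof (rule LIMSEQ_I)
    fix e :: real assume "e > 0"
    \<comment> \<open>Chosen so that C' / K is at most e/2; the summand 1 keeps K positive if C' =
      0.\<close>
    define K where "K = 2 * (C' + 1) / e"
    have "K > 0" using \<open>C' \<ge> 0\<close> \<open>e > 0\<close> by (simp add: K_def)
    have "C' / K \<le> e / 2"
      using \<open>C' \<ge> 0\<close> \<open>e > 0\<close> by (simp add: K_def divide_simps algebra_simps)
    obtain N where N: "\<And>n. n \<ge> N \<Longrightarrow> \<bar>LINT x:?I|lborel. min \<bar>G n x\<bar> K\<bar> < e / 2"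
      using LIMSEQ_D[OF lim0[OF \<open>K > 0\<close>], of "e / 2"] \<open>e > 0\<close> by auto
    show "\<exists>N. \<forall>n\<ge>N. norm ((LINT x:?I|lborel. G n x) - 0) < e"
    proof (intro exI allI impI)
      fix n assume "n \<ge> N"
      have m: "set_integrable lborel ?I (\<lambda>x. min \<bar>G n x\<bar> K)"
        using \<open>K > 0\<close> by (intro set_integrable_Icc_bounded[where C=K]) auto
      have "\<bar>LINT x:?I|lborel. G n x\<bar> \<le> (LINT x:?I|lborel. \<bar>G n x\<bar>)"
        using Gi by (rule abs_set_integral_le)
      also have "\<dots> \<le> (LINT x:?I|lborel. min \<bar>G n x\<bar> K + (G n x)\<^sup>2 / K)"
      proof (rule set_integral_mono)
        show "set_integrable lborel ?I (\<lambda>x. min \<bar>G n x\<bar> K + (G n x)\<^sup>2 / K)"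
          using m G2 by simp
        fix x
        show "\<bar>G n x\<bar> \<le> min \<bar>G n x\<bar> K + (G n x)\<^sup>2 / K"
        proof (cases "\<bar>G n x\<bar> \<le> K")
          case True then show ?thesis using \<open>K > 0\<close> by simp
        next
          case False
          then have "K * \<bar>G n x\<bar> \<le> \<bar>G n x\<bar> * \<bar>G n x\<bar>" by (intro mult_right_mono) auto
          then have "\<bar>G n x\<bar> \<le> (G n x)\<^sup>2 / K"
            using \<open>K > 0\<close> by (simp add: pos_le_divide_eq power2_eq_square mult.commute)
          then show ?thesis using \<open>K > 0\<close> by (simp add: add_increasing)
        qed
      qed (use Gi in \<open>rule set_integrable_abs\<close>)
      also have "\<dots> = (LINT x:?I|lborel. min \<bar>G n x\<bar> K) + (LINT x:?I|lborel. (G n x)\<^sup>2) / K"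
        using m G2 by simp
      also have "(LINT x:?I|lborel. (G n x)\<^sup>2) / K \<le> e / 2"
        using C'[of n] \<open>K > 0\<close> \<open>C' / K \<le> e / 2\<close> by (meson divide_right_mono less_eq_real_def order_trans)
      finally show "norm ((LINT x:?I|lborel. G n x) - 0) < e" using N[OF \<open>n \<ge> N\<close>] by simp
    qed
  qed
  moreover have "(LINT x:?I|lborel. G n x) = (LINT x:?I|lborel. F n x) - (LINT x:?I|lborel. f x)" for n
    unfolding G_def
    by (intro set_integral_diff(2) set_integrable_Icc_of_square[OF _ int] set_integrable_Icc_of_square[OF _ f])
      auto
  ultimately show ?thesis by (simp add: LIM_zero_iff)
qed

section \<open>The singular initial value problem\<close>

text \<open>Testing \<open>u' = b (f(u) + g)\<close> with \<open>u'\<close>: the term \<open>\<integral> f(u) u'\<close> is \<open>\<Phi>(u(T))\<close> for the antiderivative \<open>\<Phi>\<close>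
  of \<open>f\<close>, so only the integrability of \<open>f\<close> near \<open>0\<close> enters.\<close>
lemma energy_estimate:
  fixes u b f g k :: "real \<Rightarrow> real"
  assumes "0 < T" "0 < \<alpha>" and [measurable]: "b \<in> borel_measurable borel" "g \<in> borel_measurable borel"
    and b: "\<And>t. 0 < b t" "\<And>t. \<alpha> * b t \<le> 1"
    and f: "continuous_on UNIV f" and u: "continuous_on UNIV u"
    and eq: "\<And>x. x \<in> {0..T} \<Longrightarrow> u x = (LINT t:{0..x}|lborel. b t * (f (u t) + g t))"
    and g: "set_integrable lborel {0..T} (\<lambda>t. (g t)\<^sup>2)"
    and k: "integrable lborel k" "\<And>s. 0 \<le> k s"
    and M: "\<And>s. s \<noteq> 0 \<Longrightarrow> \<bar>f s\<bar> \<le> k s + M" "0 \<le> M"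
  shows "set_integrable lborel {0..T} (\<lambda>t. (b t * (f (u t) + g t))\<^sup>2)" (is ?int)
    and "(LINT t:{0..T}|lborel. (b t * (f (u t) + g t))\<^sup>2)
      \<le> 2 / \<alpha> * ((LINT t|lborel. k t) + M\<^sup>2 * T / \<alpha> + (LINT t:{0..T}|lborel. (g t)\<^sup>2) / \<alpha>)"
proof -
  have [measurable]: "f \<in> borel_measurable borel" "u \<in> borel_measurable borel"
    using f u by (auto intro: borel_measurable_continuous_onI)
  define du where "du t = b t * (f (u t) + g t)" for t
  have [measurable]: "du \<in> borel_measurable borel" unfolding du_def by measurable
  have cont_fu: "continuous_on A (\<lambda>t. f (u t))" for A
    by (rule continuous_on_compose2[OF f]) (auto intro: continuous_on_subset[OF u])
  have fu2: "set_integrable lborel {0..T} (\<lambda>t. (f (u t))\<^sup>2)"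
    unfolding set_integrable_def
    by (rule borel_integrable_compact) (auto intro!: continuous_intros cont_fu)
  have \<alpha>b: "\<bar>\<alpha> * du t\<bar> \<le> \<bar>f (u t) + g t\<bar>" for t
  proof -
    have "\<bar>\<alpha> * du t\<bar> = (\<alpha> * b t) * \<bar>f (u t) + g t\<bar>"
      using b(1)[of t] \<open>0 < \<alpha>\<close> by (simp add: du_def abs_mult)
    also have "\<dots> \<le> 1 * \<bar>f (u t) + g t\<bar>" by (intro mult_right_mono b) auto
    finally show ?thesis by simp
  qed
  have "set_integrable lborel {0..T} (\<lambda>t. (\<alpha> * du t)\<^sup>2)"
  proof (rule set_integrable_bound[where f="\<lambda>t. (f (u t) + g t)\<^sup>2"])
    show "set_integrable lborel {0..T} (\<lambda>t. (f (u t) + g t)\<^sup>2)"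
      by (rule set_integrable_square_add) (use fu2 g in auto)
    show "set_borel_measurable lborel {0..T} (\<lambda>t. (\<alpha> * du t)\<^sup>2)"
      by (simp add: set_borel_measurable_def)
    show "AE t in lborel. t \<in> {0..T} \<longrightarrow> norm ((\<alpha> * du t)\<^sup>2) \<le> norm ((f (u t) + g t)\<^sup>2)"
      using \<alpha>b by (auto simp: abs_le_square_iff[symmetric])
  qed
  then have du2: "set_integrable lborel {0..T} (\<lambda>t. (du t)\<^sup>2)"
    using \<open>0 < \<alpha>\<close> by (simp add: power_mult_distrib)
  then show ?int by (simp add: du_def)
  have du1: "set_integrable lborel {0..T} du" by (rule set_integrable_Icc_of_square[OF _ du2]) simp
  have dua: "set_integrable lborel {0..T} (\<lambda>t. \<bar>du t\<bar>)" using du1 by (rule set_integrable_abs)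
  obtain \<Phi> where \<Phi>: "\<And>s. (\<Phi> has_real_derivative f s) (at s)" "\<Phi> 0 = 0"
    "\<And>s. \<bar>\<Phi> s\<bar> \<le> (LINT t|lborel. k t) + M * \<bar>s\<bar>"
    using antiderivative_linear_bound[OF f k M(1)] by blast
  have eq': "u x = (LINT t:{0..x}|lborel. du t)" if "x \<in> {0..T}" for x
    using eq[OF that] by (simp add: du_def)
  have "u 0 = 0"
    using eq'[of 0] set_integral_Icc_combine[OF set_integrable_subset[OF du1], of 0 0 0] \<open>0 < T\<close> by simp
  note chain = chain_rule_indefinite_integral[OF less_imp_le[OF \<open>0 < T\<close>] _ du1 eq' u \<Phi>(1) f]
  have int_fu: "set_integrable lborel {0..T} (\<lambda>t. f (u t) * du t)" by (rule chain) auto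
  have \<Phi>_u: "\<Phi> (u T) = (LINT t:{0..T}|lborel. f (u t) * du t)"
    using chain(2) \<open>u 0 = 0\<close> \<Phi>(2) by simp
  \<comment> \<open>The weight \<alpha>/4 looks ahead: the inequality is used once for g u' and once
    for M |u'|, which together cost \<alpha>/2 of the \<alpha> on the left side of the energy
    inequality.\<close>
  have young: "s * t \<le> s\<^sup>2 / \<alpha> + \<alpha> / 4 * t\<^sup>2" for s t
  proof -
    have "0 \<le> (s - \<alpha> / 2 * t)\<^sup>2 / \<alpha>" using \<open>0 < \<alpha>\<close> by simp
    also have "\<dots> = s\<^sup>2 / \<alpha> + \<alpha> / 4 * t\<^sup>2 - s * t"
      using \<open>0 < \<alpha>\<close> by (simp add: power2_eq_square field_simps)
    finally show ?thesis by simp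
  qed
  define Du where "Du = (LINT t:{0..T}|lborel. (du t)\<^sup>2)"
  define G where "G = (LINT t:{0..T}|lborel. (g t)\<^sup>2)"
  define J where "J = (LINT t|lborel. k t)"
  have gdu: "set_integrable lborel {0..T} (\<lambda>t. g t * du t)"
  proof (rule set_integrable_bound[where f="\<lambda>t. (g t)\<^sup>2 / \<alpha> + \<alpha> / 4 * (du t)\<^sup>2"])
    show "set_integrable lborel {0..T} (\<lambda>t. (g t)\<^sup>2 / \<alpha> + \<alpha> / 4 * (du t)\<^sup>2)"
      using g du2 \<open>0 < \<alpha>\<close> by simp
    show "set_borel_measurable lborel {0..T} (\<lambda>t. g t * du t)"
      by (simp add: set_borel_measurable_def)
    have "\<bar>s * t\<bar> \<le> \<bar>s\<^sup>2 / \<alpha> + \<alpha> / 4 * t\<^sup>2\<bar>" for s t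
      using young[of s t] young[of "- s" t] by simp
    then show "AE t in lborel. t \<in> {0..T} \<longrightarrow> norm (g t * du t) \<le> norm ((g t)\<^sup>2 / \<alpha> + \<alpha> / 4 * (du t)\<^sup>2)"
      by auto
  qed
  have I1: "(LINT t:{0..T}|lborel. g t * du t) \<le> G / \<alpha> + \<alpha> / 4 * Du"
  proof -
    have "(LINT t:{0..T}|lborel. g t * du t) \<le> (LINT t:{0..T}|lborel. (g t)\<^sup>2 / \<alpha> + \<alpha> / 4 * (du t)\<^sup>2)"
      by (rule set_integral_mono[OF gdu]) (use g du2 \<open>0 < \<alpha>\<close> young in auto)
    also have "\<dots> = G / \<alpha> + \<alpha> / 4 * Du"
      using g du2 \<open>0 < \<alpha>\<close> by (simp add: Du_def G_def)
    finally show ?thesis .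
  qed
  have c: "set_integrable lborel {0..T} (\<lambda>t. c)" for c :: real
    by (rule set_integrable_Icc_bounded[where C="\<bar>c\<bar>"]) auto
  \<comment> \<open>The linear growth of \<Phi> has to be absorbed as well: |u(T)| is at most the
    integral of |u'|, and Young's inequality returns this to the energy.\<close>
  have I2: "M * \<bar>u T\<bar> \<le> M\<^sup>2 * T / \<alpha> + \<alpha> / 4 * Du"
  proof -
    have "\<bar>u T\<bar> \<le> (LINT t:{0..T}|lborel. \<bar>du t\<bar>)"
      using abs_set_integral_le[OF du1] eq'[of T] \<open>0 < T\<close> by simp
    then have "M * \<bar>u T\<bar> \<le> M * (LINT t:{0..T}|lborel. \<bar>du t\<bar>)" by (rule mult_left_mono) (rule M)
    also have "\<dots> = (LINT t:{0..T}|lborel. M * \<bar>du t\<bar>)" by simp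
    also have "\<dots> \<le> (LINT t:{0..T}|lborel. M\<^sup>2 / \<alpha> + \<alpha> / 4 * (du t)\<^sup>2)"
    proof (rule set_integral_mono)
      show "set_integrable lborel {0..T} (\<lambda>t. M * \<bar>du t\<bar>)" using dua by simp
      show "set_integrable lborel {0..T} (\<lambda>t. M\<^sup>2 / \<alpha> + \<alpha> / 4 * (du t)\<^sup>2)"
        using c du2 \<open>0 < \<alpha>\<close> by simp
      show "M * \<bar>du t\<bar> \<le> M\<^sup>2 / \<alpha> + \<alpha> / 4 * (du t)\<^sup>2" for t using young[of M "\<bar>du t\<bar>"] by simp
    qed
    also have "\<dots> = M\<^sup>2 * T / \<alpha> + \<alpha> / 4 * Du"
      using c[of "M\<^sup>2 / \<alpha>"] du2 \<open>0 < \<alpha>\<close> \<open>0 < T\<close> set_integral_Icc_const[of 0 T "M\<^sup>2 / \<alpha>"]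
      by (simp only: set_integral_add set_integrable_mult_right set_integral_mult_right Du_def) simp
    finally show ?thesis .
  qed
  have "\<alpha> * Du = (LINT t:{0..T}|lborel. \<alpha> * (du t)\<^sup>2)" by (simp add: Du_def)
  also have "\<dots> \<le> (LINT t:{0..T}|lborel. f (u t) * du t + g t * du t)"
  proof (rule set_integral_mono)
    show "set_integrable lborel {0..T} (\<lambda>t. \<alpha> * (du t)\<^sup>2)" using du2 by simp
    show "set_integrable lborel {0..T} (\<lambda>t. f (u t) * du t + g t * du t)" using int_fu gdu by simp
    fix t
    \<comment> \<open>As u' = b (f(u) + g), the product (f(u) + g) u' equals b (f(u) + g)^2, and
      \<alpha> b \<le> 1 gives the comparison.\<close>
    have "(\<alpha> * b t) * (b t * (f (u t) + g t)\<^sup>2) \<le> 1 * (b t * (f (u t) + g t)\<^sup>2)"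
      using b(1)[of t] by (intro mult_right_mono b) (auto intro!: mult_nonneg_nonneg)
    then show "\<alpha> * (du t)\<^sup>2 \<le> f (u t) * du t + g t * du t"
      by (simp add: du_def power2_eq_square algebra_simps)
  qed
  also have "\<dots> = \<Phi> (u T) + (LINT t:{0..T}|lborel. g t * du t)"
    using int_fu gdu by (simp add: \<Phi>_u)
  also have "\<dots> \<le> (J + (M\<^sup>2 * T / \<alpha> + \<alpha> / 4 * Du)) + (G / \<alpha> + \<alpha> / 4 * Du)"
    using \<Phi>(3)[of "u T"] I1 I2 unfolding J_def by linarith
  finally have "\<alpha> * Du \<le> (J + (M\<^sup>2 * T / \<alpha> + \<alpha> / 4 * Du)) + (G / \<alpha> + \<alpha> / 4 * Du)" .
  moreover have "\<alpha> / 4 * Du = (\<alpha> * Du) / 4" "\<alpha> / 2 * Du = (\<alpha> * Du) / 2" by simp_all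
  ultimately have "\<alpha> / 2 * Du \<le> J + M\<^sup>2 * T / \<alpha> + G / \<alpha>" by linarith
  then have "2 / \<alpha> * (\<alpha> / 2 * Du) \<le> 2 / \<alpha> * (J + M\<^sup>2 * T / \<alpha> + G / \<alpha>)"
    using \<open>0 < \<alpha>\<close> by (intro mult_left_mono) auto
  then show "(LINT t:{0..T}|lborel. (b t * (f (u t) + g t))\<^sup>2)
      \<le> 2 / \<alpha> * ((LINT t|lborel. k t) + M\<^sup>2 * T / \<alpha> + (LINT t:{0..T}|lborel. (g t)\<^sup>2) / \<alpha>)"
    using \<open>0 < \<alpha>\<close> by (simp add: Du_def J_def G_def du_def)
qed

text \<open>\<open>h\<close> is the nonlinearity with a real junk value at 0: that value must obey
  the bounds but not continuity, and the blow-up is a limit over punctured neighbourhoods. In the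
  growth bound \<open>k\<close> carries the integrable singularity and \<open>M\<close> the bounded
  remainder.\<close>

locale singular_flux =
  fixes h k :: "real \<Rightarrow> real" and m M :: real
  assumes cont: "continuous_on (- {0}) h"
    and blowup: "filterlim h at_top (at 0)"
    and below: "\<And>s. - m \<le> h s"
    and k_integrable: "integrable lborel k" and k_nonneg: "\<And>s. 0 \<le> k s"
    and growth: "\<And>s. \<bar>h s\<bar> \<le> k s + M"
begin

lemma measurable_h [measurable]: "h \<in> borel_measurable borel"
  using cont by (intro borel_measurable_continuous_countable_exceptions[of "{0}"]) auto

lemma isCont_h: "s \<noteq> 0 \<Longrightarrow> isCont h s"
  using cont continuous_on_eq_continuous_at[of "- {0}" h] by auto

text \<open>Squeezed between -m and \<open>h s\<close>, the inf-convolution inherits a bound that is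
  free of \<open>n\<close>. This uniformity is what approximation from below buys.\<close>

lemma inf_convolution_growth:
  assumes "s \<noteq> 0"
  shows "\<bar>inf_convolution n h s\<bar> \<le> k s + (\<bar>M\<bar> + \<bar>m\<bar>)"
proof -
  have "- m \<le> inf_convolution n h s"
    by (rule inf_convolution_ge) (use below in \<open>simp add: add_increasing2\<close>)
  moreover have "inf_convolution n h s \<le> h s" by (rule inf_convolution_le[OF below assms])
  ultimately show ?thesis using growth[of s] k_nonneg[of s] by linarith
qed

text \<open>The lower estimate is the penalty argument with C just below \<open>h s\<close>; the
  upper one is the choice t = \<open>\<sigma> n\<close> in the infimum, allowed once
  \<open>\<sigma> n\<close> is nonzero, together with continuity of \<open>h\<close> at
  \<open>s\<close>.\<close>

lemma tendsto_inf_convolution: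
  assumes "\<sigma> \<longlonglongrightarrow> s" "s \<noteq> 0" "strict_mono r"
  shows "(\<lambda>n. inf_convolution (r n) h (\<sigma> n)) \<longlonglongrightarrow> h s"
proof (rule order_tendstoI)
  fix c assume "c < h s"
  then obtain C where C: "c < C" "C < h s" using dense by blast
  have "\<forall>\<^sub>F t in at s. C < h t"
    using isCont_h[OF assms(2)] C(2) unfolding isCont_def by (rule order_tendstoD)
  then have "\<forall>\<^sub>F t in at s. C \<le> h t" by eventually_elim simp
  then have "\<forall>\<^sub>F n in sequentially. C \<le> inf_convolution (r n) h (\<sigma> n)"
    using C by (intro inf_convolution_eventually_ge[OF below assms(1,3)]) auto
  then show "\<forall>\<^sub>F n in sequentially. c < inf_convolution (r n) h (\<sigma> n)"
    by eventually_elim (use C in simp)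
next
  fix c assume "h s < c"
  have "(\<lambda>n. h (\<sigma> n)) \<longlonglongrightarrow> h s" by (rule isCont_tendsto_compose[OF isCont_h[OF assms(2)] assms(1)])
  then have "\<forall>\<^sub>F n in sequentially. h (\<sigma> n) < c" using \<open>h s < c\<close> by (rule order_tendstoD)
  moreover have "\<forall>\<^sub>F n in sequentially. \<sigma> n \<noteq> 0"
    using assms(1,2) by (rule tendsto_imp_eventually_ne)
  ultimately show "\<forall>\<^sub>F n in sequentially. inf_convolution (r n) h (\<sigma> n) < c"
    by eventually_elim (use inf_convolution_le[OF below] in \<open>meson le_less_trans\<close>)
qed

lemma inf_convolution_tendsto_at_top:
  assumes "\<sigma> \<longlonglongrightarrow> 0" "strict_mono r"
  shows "filterlim (\<lambda>n. inf_convolution (r n) h (\<sigma> n)) at_top sequentially"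
  unfolding filterlim_at_top
  using blowup inf_convolution_eventually_ge[OF below assms] by (auto simp: filterlim_at_top)

text \<open>\<open>b\<close> is the reciprocal of the coefficient a. Its two bounds act at different
  places: \<alpha> b \<le> 1 gives the energy estimate for u', and 1 \<le> \<beta> b recovers an L^2
  bound on phi(u) from it.\<close>

theorem singular_initial_value_problem:
  fixes b g :: "real \<Rightarrow> real"
  assumes "0 < T" "0 < \<alpha>" and [measurable]: "b \<in> borel_measurable borel" "g \<in> borel_measurable borel"
    and b: "\<And>t. 0 < b t" "\<And>t. \<alpha> * b t \<le> 1" "\<And>t. 1 \<le> \<beta> * b t"
    and g: "set_integrable lborel {0..T} (\<lambda>t. (g t)\<^sup>2)"
  obtains u where "continuous_on UNIV u"
    "AE x in lborel. x \<in> {0..T} \<longrightarrow> u x \<noteq> 0"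
    "set_integrable lborel {0..T} (\<lambda>t. (h (u t))\<^sup>2)"
    "set_integrable lborel {0..T} (\<lambda>t. (b t * (h (u t) + g t))\<^sup>2)"
    "\<And>x. x \<in> {0..T} \<Longrightarrow> u x = (LINT t:{0..x}|lborel. b t * (h (u t) + g t))"
proof -
  define f where "f n = inf_convolution n h" for n
  define M' where "M' = \<bar>M\<bar> + \<bar>m\<bar>"
  define G where "G = (LINT t:{0..T}|lborel. (g t)\<^sup>2)"
  define E where "E = 2 / \<alpha> * ((LINT t|lborel. k t) + M'\<^sup>2 * T / \<alpha> + G / \<alpha>)"
  have lip: "\<bar>f n s - f n t\<bar> \<le> real n * \<bar>s - t\<bar>" for n s t
    unfolding f_def by (rule inf_convolution_lipschitz[OF below])
  have cont_f: "continuous_on UNIV (f n)" for n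
  proof (rule uniformly_continuous_imp_continuous, rule lipschitz_on_uniformly_continuous)
    show "(real n)-lipschitz_on UNIV (f n)"
      using lip by (intro lipschitz_onI) (auto simp: dist_real_def)
  qed
  have [measurable]: "f n \<in> borel_measurable borel" for n
    by (rule borel_measurable_continuous_onI[OF cont_f])
  have g1: "set_integrable lborel {0..T} g" by (rule set_integrable_Icc_of_square[OF _ g]) simp
  have b_le: "b t \<le> 1 / \<alpha>" for t
    using b(2)[of t] \<open>0 < \<alpha>\<close> by (simp add: pos_le_divide_eq mult.commute)
  have bg: "set_integrable lborel {0..T} (\<lambda>t. b t * g t)"
  proof (rule set_integrable_bound[where f="\<lambda>t. 1 / \<alpha> * g t"])
    show "set_integrable lborel {0..T} (\<lambda>t. 1 / \<alpha> * g t)" using g1 \<open>0 < \<alpha>\<close> by simp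
    show "set_borel_measurable lborel {0..T} (\<lambda>t. b t * g t)" by (simp add: set_borel_measurable_def)
    have "\<bar>b t * g t\<bar> \<le> \<bar>1 / \<alpha> * g t\<bar>" for t
      unfolding abs_mult using b_le[of t] b(1)[of t] \<open>0 < \<alpha>\<close> by (intro mult_right_mono) auto
    then show "AE t in lborel. t \<in> {0..T} \<longrightarrow> norm (b t * g t) \<le> norm (1 / \<alpha> * g t)" by auto
  qed
  have "\<exists>v. continuous_on UNIV v \<and>
    (\<forall>x\<in>{0..T}. v x = (LINT t:{0..x}|lborel. b t * (f n (v t) + g t)))" for n
  proof -
    have bB: "\<bar>b t\<bar> \<le> 1 / \<alpha>" for t using b_le[of t] b(1)[of t] by simp
    obtain v where "continuous_on UNIV v"
      "\<And>x. x \<in> {0..T} \<Longrightarrow> v x = (LINT t:{0..x}|lborel. b t * f n (v t) + b t * g t)"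
      by (rule lipschitz_integral_equation[where b=b, OF \<open>0 < T\<close> lip[of n] _ _ bB bg]) auto
    then show ?thesis by (intro exI[of _ v]) (auto simp: distrib_left)
  qed
  then obtain v where cont_v: "\<And>n. continuous_on UNIV (v n)"
    and v: "\<And>n x. x \<in> {0..T} \<Longrightarrow> v n x = (LINT t:{0..x}|lborel. b t * (f n (v n t) + g t))"
    by metis
  have [measurable]: "v n \<in> borel_measurable borel" for n
    by (rule borel_measurable_continuous_onI[OF cont_v])
  define dv where "dv n t = b t * (f n (v n t) + g t)" for n t
  have [measurable]: "dv n \<in> borel_measurable borel" for n unfolding dv_def by measurable
  have growth': "\<bar>f n s\<bar> \<le> k s + M'" if "s \<noteq> 0" for n s
    unfolding f_def M'_def by (rule inf_convolution_growth[OF that])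
  have "0 \<le> M'" by (simp add: M'_def)
  note energy = energy_estimate[OF \<open>0 < T\<close> \<open>0 < \<alpha>\<close> \<open>b \<in> _\<close> \<open>g \<in> _\<close> b(1,2) cont_f cont_v v g
    k_integrable k_nonneg growth' \<open>0 \<le> M'\<close>, folded dv_def G_def, folded E_def]
  have dv2: "set_integrable lborel {0..T} (\<lambda>t. (dv n t)\<^sup>2)" for n
    using energy(1) by simp
  have E: "(LINT t:{0..T}|lborel. (dv n t)\<^sup>2) \<le> E" for n
    using energy(2) by simp
  have "E \<ge> 0" using E[of 0] by (rule order_trans[rotated]) (intro set_integral_nonneg, auto)
  have dv1: "set_integrable lborel {0..T} (dv n)" for n
    by (rule set_integrable_Icc_of_square[OF _ dv2]) simp
  have v': "v n x = (LINT t:{0..x}|lborel. dv n t)" if "x \<in> {0..T}" for n x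
    using v[OF that] by (simp add: dv_def)
  \<comment> \<open>The free Young parameter \<eta> replaces the Hoelder-1/2 estimate: \<eta> = 1
    gives the uniform bound, and small \<eta> followed by small y - x gives equicontinuity.\<close>
  have incr: "\<bar>v n y - v n x\<bar> \<le> \<eta> * E + (y - x) / (4 * \<eta>)"
    if "0 \<le> x" "x \<le> y" "y \<le> T" "\<eta> > 0" for n x y \<eta>
  proof -
    have xy: "set_integrable lborel {x..y} F" if "set_integrable lborel {0..T} F" for F :: "real \<Rightarrow> real"
      using \<open>0 \<le> x\<close> \<open>y \<le> T\<close> by (intro set_integrable_subset[OF that]) auto
    have c: "set_integrable lborel {x..y} (\<lambda>t. c)" for c :: real
      by (rule set_integrable_Icc_bounded[where C="\<bar>c\<bar>"]) auto
    have "v n y - v n x = (LINT t:{x..y}|lborel. dv n t)"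
      using v'[of x n] v'[of y n] that
        set_integral_Icc_combine[OF set_integrable_subset[OF dv1], of 0 y x n] by simp
    then have "\<bar>v n y - v n x\<bar> \<le> (LINT t:{x..y}|lborel. \<bar>dv n t\<bar>)"
      using abs_set_integral_le[OF xy[OF dv1]] by simp
    also have "\<dots> \<le> (LINT t:{x..y}|lborel. \<eta> * (dv n t)\<^sup>2 + 1 / (4 * \<eta>))"
    proof (rule set_integral_mono)
      show "set_integrable lborel {x..y} (\<lambda>t. \<bar>dv n t\<bar>)" by (rule set_integrable_abs[OF xy[OF dv1]])
      show "set_integrable lborel {x..y} (\<lambda>t. \<eta> * (dv n t)\<^sup>2 + 1 / (4 * \<eta>))"
        using xy[OF dv2] c by simp
      fix t
      have "0 \<le> \<eta> * (\<bar>dv n t\<bar> - 1 / (2 * \<eta>))\<^sup>2" using \<open>\<eta> > 0\<close> by simp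
      also have "\<dots> = \<eta> * (dv n t)\<^sup>2 + 1 / (4 * \<eta>) - \<bar>dv n t\<bar>"
        using \<open>\<eta> > 0\<close> by (simp add: power2_diff field_simps) (simp add: power2_eq_square field_simps)
      finally show "\<bar>dv n t\<bar> \<le> \<eta> * (dv n t)\<^sup>2 + 1 / (4 * \<eta>)" by simp
    qed
    also have "\<dots> = \<eta> * (LINT t:{x..y}|lborel. (dv n t)\<^sup>2) + (y - x) / (4 * \<eta>)"
      using xy[OF dv2] c set_integral_Icc_const[OF \<open>x \<le> y\<close>, of "1 / (4 * \<eta>)"]
      by (simp only: set_integral_add set_integrable_mult_right set_integral_mult_right) simp
    also have "(LINT t:{x..y}|lborel. (dv n t)\<^sup>2) \<le> (LINT t:{0..T}|lborel. (dv n t)\<^sup>2)"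
      using that dv2[of n] unfolding set_lebesgue_integral_def set_integrable_def
      by (intro integral_mono) (use xy[OF dv2] in \<open>auto simp: indicator_def set_integrable_def\<close>)
    also have "\<dots> \<le> E" by (rule E)
    finally show ?thesis using \<open>\<eta> > 0\<close> by simp
  qed
  have v0: "v n 0 = 0" for n
    using v'[of 0 n] set_integral_Icc_combine[OF set_integrable_subset[OF dv1], of 0 0 0 n] \<open>0 < T\<close> by simp
  obtain w r where cont_w: "continuous_on {0..T} w" and r: "strict_mono (r :: nat \<Rightarrow> nat)"
    and w: "\<And>e. 0 < e \<Longrightarrow> \<exists>N. \<forall>n x. n \<ge> N \<and> x \<in> {0..T} \<longrightarrow> norm (v (r n) x - w x) < e"
  proof (rule Arzela_Ascoli[of "{0..T}" v "E + T"])
    show "norm (v n x) \<le> E + T" if "x \<in> {0..T}" for n x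
      using incr[of 0 x 1 n] v0[of n] that by auto
    fix x e :: real assume x: "x \<in> {0..T}" and "0 < e"
    \<comment> \<open>Makes \<eta> E at most e/2, the summand 1 guarding against E = 0; the radius 2
      \<eta> e below then makes the other term less than e/2.\<close>
    define \<eta> where "\<eta> = e / (2 * (E + 1))"
    have "\<eta> > 0" using \<open>0 < e\<close> \<open>E \<ge> 0\<close> by (simp add: \<eta>_def)
    have "\<eta> * E \<le> e / 2" using \<open>0 < e\<close> \<open>E \<ge> 0\<close> by (simp add: \<eta>_def divide_simps)
    show "\<exists>d. 0 < d \<and> (\<forall>n y. y \<in> {0..T} \<and> norm (x - y) < d \<longrightarrow> norm (v n x - v n y) < e)"
    proof (intro exI[of _ "2 * \<eta> * e"] conjI allI impI)
      show "0 < 2 * \<eta> * e" using \<open>\<eta> > 0\<close> \<open>0 < e\<close> by simp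
      fix n y assume y: "y \<in> {0..T} \<and> norm (x - y) < 2 * \<eta> * e"
      have "\<bar>v n x - v n y\<bar> \<le> \<eta> * E + \<bar>x - y\<bar> / (4 * \<eta>)"
        using incr[of x y \<eta> n] incr[of y x \<eta> n] x y \<open>\<eta> > 0\<close>
        by (cases "x \<le> y") (auto simp: abs_minus_commute)
      also have "\<bar>x - y\<bar> / (4 * \<eta>) < e / 2"
        using y \<open>\<eta> > 0\<close> by (simp add: pos_divide_less_eq mult.commute)
      finally show "norm (v n x - v n y) < e" using \<open>\<eta> * E \<le> e / 2\<close> by simp
    qed
  qed auto
  define u where "u x = w (max 0 (min T x))" for x
  have cont_u: "continuous_on UNIV u"
    unfolding u_def using \<open>0 < T\<close>
    by (intro continuous_on_compose2[OF cont_w] continuous_intros) auto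
  have [measurable]: "u \<in> borel_measurable borel"
    by (rule borel_measurable_continuous_onI[OF cont_u])
  have lim: "(\<lambda>n. v (r n) x) \<longlonglongrightarrow> u x" if "x \<in> {0..T}" for x
    using w that by (intro LIMSEQ_I) (force simp: u_def)
  define F where "F n x = f (r n) (v (r n) x)" for n x
  have [measurable]: "F n \<in> borel_measurable borel" for n unfolding F_def by measurable
  define C where "C = 2 * \<beta>\<^sup>2 * E + 2 * G"
  have F2_le: "(F n x)\<^sup>2 \<le> 2 * \<beta>\<^sup>2 * (dv (r n) x)\<^sup>2 + 2 * (g x)\<^sup>2" for n x
  proof -
    have "\<bar>F n x + g x\<bar> \<le> \<bar>\<beta> * dv (r n) x\<bar>"
    proof -
      have "1 * \<bar>F n x + g x\<bar> \<le> (\<beta> * b x) * \<bar>F n x + g x\<bar>" by (intro mult_right_mono b) auto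
      also have "\<dots> \<le> \<bar>\<beta> * b x\<bar> * \<bar>F n x + g x\<bar>" by (intro mult_right_mono) auto
      also have "\<dots> = \<bar>\<beta> * dv (r n) x\<bar>" by (simp add: dv_def F_def abs_mult)
      finally show ?thesis by simp
    qed
    then have "(F n x + g x)\<^sup>2 \<le> \<beta>\<^sup>2 * (dv (r n) x)\<^sup>2"
      by (simp add: abs_le_square_iff power_mult_distrib)
    moreover have "(F n x)\<^sup>2 \<le> 2 * (F n x + g x)\<^sup>2 + 2 * (g x)\<^sup>2"
      using zero_le_power2[of "F n x + 2 * g x"] by (simp add: power2_eq_square algebra_simps)
    ultimately show ?thesis by linarith
  qed
  have bnd: "set_integrable lborel {0..T} (\<lambda>x. 2 * \<beta>\<^sup>2 * (dv (r n) x)\<^sup>2 + 2 * (g x)\<^sup>2)" for n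
    using dv2[of "r n"] g by (intro set_integral_add(1) set_integrable_mult_right)
  have F2: "set_integrable lborel {0..T} (\<lambda>x. (F n x)\<^sup>2)" for n
    by (rule set_integrable_bound[OF bnd[of n]]) (use F2_le in \<open>auto simp: set_borel_measurable_def\<close>)
  have FC: "(LINT x:{0..T}|lborel. (F n x)\<^sup>2) \<le> C" for n
  proof -
    have "(LINT x:{0..T}|lborel. (F n x)\<^sup>2)
        \<le> (LINT x:{0..T}|lborel. 2 * \<beta>\<^sup>2 * (dv (r n) x)\<^sup>2 + 2 * (g x)\<^sup>2)"
      by (rule set_integral_mono[OF F2 bnd F2_le])
    also have "\<dots> = 2 * \<beta>\<^sup>2 * (LINT x:{0..T}|lborel. (dv (r n) x)\<^sup>2) + 2 * G"
      using dv2[of "r n"] g unfolding G_def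
      by (simp only: set_integral_add set_integrable_mult_right set_integral_mult_right)
    also have "\<dots> \<le> C" unfolding C_def by (intro add_mono mult_left_mono E) auto
    finally show ?thesis .
  qed
  have Fconv: "(\<lambda>n. F n x) \<longlonglongrightarrow> h (u x)" if "x \<in> {0..T}" "u x \<noteq> 0" for x
    unfolding F_def f_def by (rule tendsto_inf_convolution[OF lim[OF that(1)] that(2) r])
  have Ftop: "filterlim (\<lambda>n. F n x) at_top sequentially" if "x \<in> {0..T}" "u x = 0" for x
    unfolding F_def f_def using lim[OF that(1)] that(2) r by (intro inf_convolution_tendsto_at_top) auto
  \<comment> \<open>With values in the extended nonnegative reals Fatou's lemma does two jobs: a
    liminf that is finite a.e. confines the zeros of \<open>u\<close> to a null set, and off the
    zeros the liminf is h(u)^2.\<close>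
  define \<phi> where "\<phi> n x = ennreal (indicator {0..T} x *\<^sub>R (F n x)\<^sup>2)" for n x
  have [measurable]: "\<phi> n \<in> borel_measurable lborel" for n unfolding \<phi>_def by measurable
  have fatou: "(\<integral>\<^sup>+x. liminf (\<lambda>n. \<phi> n x) \<partial>lborel) \<le> ennreal C"
  proof -
    have "(\<integral>\<^sup>+x. \<phi> n x \<partial>lborel) \<le> ennreal C" for n
    proof -
      have "(\<integral>\<^sup>+x. \<phi> n x \<partial>lborel) = ennreal (LINT x:{0..T}|lborel. (F n x)\<^sup>2)"
        unfolding \<phi>_def set_lebesgue_integral_def
        using F2[of n] by (intro nn_integral_eq_integral) (auto simp: set_integrable_def)
      then show ?thesis using FC[of n] by (simp add: ennreal_leI)
    qed
    then have "liminf (\<lambda>n. \<integral>\<^sup>+x. \<phi> n x \<partial>lborel) \<le> ennreal C"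
      by (intro order_trans[OF Liminf_le_Limsup] Limsup_bounded) auto
    then show ?thesis using nn_integral_liminf[of \<phi> lborel] by (auto intro: order_trans)
  qed
  have u_ne: "AE x in lborel. x \<in> {0..T} \<longrightarrow> u x \<noteq> 0"
  proof -
    have "AE x in lborel. liminf (\<lambda>n. \<phi> n x) \<noteq> \<infinity>"
      using fatou by (intro nn_integral_PInf_AE) (auto simp: top_unique)
    then show ?thesis
    proof eventually_elim
      case (elim x)
      show ?case
      proof (intro impI notI)
        assume x: "x \<in> {0..T}" "u x = 0"
        obtain K :: nat where K: "liminf (\<lambda>n. \<phi> n x) \<le> of_nat K"
          using ennreal_Ex_less_of_nat[of "liminf (\<lambda>n. \<phi> n x)"] elim
          by (auto simp: less_top intro: less_imp_le)
        have "\<forall>\<^sub>F n in sequentially. real (Suc K) \<le> F n x"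
          using Ftop[OF x] by (simp add: filterlim_at_top)
        then have "\<forall>\<^sub>F n in sequentially. of_nat (Suc K) \<le> \<phi> n x"
        proof eventually_elim
          case (elim n)
          \<comment> \<open>\<open>F n x\<close> is at least K + 1, hence at least 1, so the bound K
            + 1 survives squaring; it contradicts the bound K on the liminf.\<close>
          have "real (Suc K) * 1 \<le> F n x * F n x" using elim by (intro mult_mono) auto
          then show ?case using x
            by (simp add: \<phi>_def power2_eq_square ennreal_of_nat_eq_real_of_nat del: of_nat_Suc)
        qed
        then have "of_nat (Suc K) \<le> liminf (\<lambda>n. \<phi> n x)" by (rule Liminf_bounded)
        then have "(of_nat (Suc K) :: ennreal) \<le> of_nat K" using K by (rule order_trans)
        then show False by simp
      qed
    qed
  qed
  have hu2: "set_integrable lborel {0..T} (\<lambda>t. (h (u t))\<^sup>2)"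
    unfolding set_integrable_def
  proof (rule integrableI_nonneg)
    have "(\<integral>\<^sup>+x. ennreal (indicator {0..T} x *\<^sub>R (h (u x))\<^sup>2) \<partial>lborel) = (\<integral>\<^sup>+x. liminf (\<lambda>n. \<phi> n x) \<partial>lborel)"
    proof (rule nn_integral_cong_AE)
      show "AE x in lborel. ennreal (indicator {0..T} x *\<^sub>R (h (u x))\<^sup>2) = liminf (\<lambda>n. \<phi> n x)"
        using u_ne
      proof eventually_elim
        case (elim x)
        have "(\<lambda>n. \<phi> n x) \<longlonglongrightarrow> ennreal (indicator {0..T} x *\<^sub>R (h (u x))\<^sup>2)"
        proof (cases "x \<in> {0..T}")
          case True
          then have "(\<lambda>n. F n x) \<longlonglongrightarrow> h (u x)" using elim Fconv by auto
          then show ?thesis unfolding \<phi>_def by (intro tendsto_intros tendsto_ennrealI)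
        next
          case False
          then show ?thesis by (simp add: \<phi>_def)
        qed
        then show ?case by (intro lim_imp_Liminf[symmetric]) auto
      qed
    qed
    then show "(\<integral>\<^sup>+x. ennreal (indicator {0..T} x *\<^sub>R (h (u x))\<^sup>2) \<partial>lborel) < \<infinity>"
      using fatou by (simp add: le_less_trans[OF _ ennreal_less_top])
  qed auto
  have "set_integrable lborel {0..T} (\<lambda>t. (h (u t) + g t)\<^sup>2)"
    by (rule set_integrable_square_add[OF _ _ _ hu2 g]) auto
  then have "set_integrable lborel {0..T} (\<lambda>t. (1 / \<alpha>)\<^sup>2 * (h (u t) + g t)\<^sup>2)"
    by (intro set_integrable_mult_right)
  then have du2: "set_integrable lborel {0..T} (\<lambda>t. (b t * (h (u t) + g t))\<^sup>2)"
  proof (rule set_integrable_bound)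
    have "(b t)\<^sup>2 \<le> (1 / \<alpha>)\<^sup>2" for t using b_le[of t] b(1)[of t] by (intro power_mono) auto
    then show "AE t in lborel. t \<in> {0..T} \<longrightarrow>
        norm ((b t * (h (u t) + g t))\<^sup>2) \<le> norm ((1 / \<alpha>)\<^sup>2 * (h (u t) + g t)\<^sup>2)"
      by (auto simp: power_mult_distrib intro!: mult_right_mono AE_I2)
  qed (simp add: set_borel_measurable_def)
  show thesis
  proof (rule that[OF cont_u u_ne hu2 du2])
    fix x assume x: "x \<in> {0..T}"
    have sub: "set_integrable lborel {0..x} F" if "set_integrable lborel {0..T} F" for F :: "real \<Rightarrow> real"
      by (rule set_integrable_subset[OF that]) (use x in auto)
    \<comment> \<open>The derivatives converge a.e. because \<open>u\<close> is nonzero a.e., but no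
      common dominating function is at hand; the uniform L^2 bound \<open>E\<close> takes its
      place.\<close>
    have "(\<lambda>n. LINT t:{0..x}|lborel. dv (r n) t) \<longlonglongrightarrow> (LINT t:{0..x}|lborel. b t * (h (u t) + g t))"
    proof (rule tendsto_set_integral_of_L2_bounded[where C=E])
      show "AE t in lborel. t \<in> {0..x} \<longrightarrow> (\<lambda>n. dv (r n) t) \<longlonglongrightarrow> b t * (h (u t) + g t)"
        using u_ne
      proof eventually_elim
        case (elim t)
        show ?case
        proof
          assume "t \<in> {0..x}"
          then have "(\<lambda>n. F n t) \<longlonglongrightarrow> h (u t)" using elim Fconv x by auto
          then show "(\<lambda>n. dv (r n) t) \<longlonglongrightarrow> b t * (h (u t) + g t)"
            unfolding dv_def F_def by (intro tendsto_intros)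
        qed
      qed
      show "(LINT t:{0..x}|lborel. (dv (r n) t)\<^sup>2) \<le> E" for n
      proof -
        have "(LINT t:{0..x}|lborel. (dv (r n) t)\<^sup>2) \<le> (LINT t:{0..T}|lborel. (dv (r n) t)\<^sup>2)"
          using x dv2[of "r n"] sub[OF dv2, of "r n"] unfolding set_lebesgue_integral_def set_integrable_def
          by (intro integral_mono) (auto simp: indicator_def)
        then show ?thesis using E[of "r n"] by linarith
      qed
    qed (use sub[OF dv2] sub[OF du2] in auto)
    then have "(\<lambda>n. v (r n) x) \<longlonglongrightarrow> (LINT t:{0..x}|lborel. b t * (h (u t) + g t))"
      using v'[OF x] by simp
    then show "u x = (LINT t:{0..x}|lborel. b t * (h (u t) + g t))"
      using lim[OF x] LIMSEQ_unique by blast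
  qed
qed

end

section \<open>Trajectories of finite energy\<close>

text \<open>No differential equation appears: any forcing is allowed on the steering part, so it is
  enough to control u', h(u) and the zero set and to read the forcing off afterwards. The integral
  form is relative to \<open>u p\<close> so that pieces can be glued. The a.e. condition makes
  \<open>h (u x)\<close> the true value of the nonlinearity.\<close>

definition finite_energy_path ::
  "(real \<Rightarrow> real) \<Rightarrow> real \<Rightarrow> real \<Rightarrow> (real \<Rightarrow> real) \<Rightarrow> (real \<Rightarrow> real) \<Rightarrow> bool" where
  "finite_energy_path h p q u du \<longleftrightarrow>
     u \<in> borel_measurable borel \<and> du \<in> borel_measurable borel \<and>
     set_integrable lborel {p..q} (\<lambda>x. (du x)\<^sup>2) \<and>
     set_integrable lborel {p..q} (\<lambda>x. (h (u x))\<^sup>2) \<and>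
     (AE x in lborel. x \<in> {p..q} \<longrightarrow> u x \<noteq> 0) \<and>
     (\<forall>x\<in>{p..q}. u x = u p + (LINT t:{p..x}|lborel. du t))"

lemma finite_energy_pathI:
  assumes "u \<in> borel_measurable borel" "du \<in> borel_measurable borel"
    "set_integrable lborel {p..q} (\<lambda>x. (du x)\<^sup>2)"
    "set_integrable lborel {p..q} (\<lambda>x. (h (u x))\<^sup>2)"
    "AE x in lborel. x \<in> {p..q} \<longrightarrow> u x \<noteq> 0"
    "\<And>x. x \<in> {p..q} \<Longrightarrow> u x = u p + (LINT t:{p..x}|lborel. du t)"
  shows "finite_energy_path h p q u du"
  using assms unfolding finite_energy_path_def by blast

lemma finite_energy_pathD:
  assumes "finite_energy_path h p q u du"
  shows "u \<in> borel_measurable borel" "du \<in> borel_measurable borel"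
    "set_integrable lborel {p..q} (\<lambda>x. (du x)\<^sup>2)"
    "set_integrable lborel {p..q} (\<lambda>x. (h (u x))\<^sup>2)"
    "AE x in lborel. x \<in> {p..q} \<longrightarrow> u x \<noteq> 0"
    "\<And>x. x \<in> {p..q} \<Longrightarrow> u x = u p + (LINT t:{p..x}|lborel. du t)"
  using assms unfolding finite_energy_path_def by blast+

lemma set_integrable_Icc_join:
  fixes f g :: "real \<Rightarrow> real"
  assumes f: "set_integrable lborel {p..q} f" and g: "set_integrable lborel {q..r} g"
    and "p \<le> q" "q \<le> r"
  shows "set_integrable lborel {p..r} (\<lambda>x. if x \<le> q then f x else g x)" (is "set_integrable _ _ ?F")
proof -
  have "set_integrable lborel ({p..q} \<union> {q<..r}) ?F"
  proof (rule set_integrable_Un)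
    show "set_integrable lborel {p..q} ?F"
      using f by (subst set_integrable_cong[of _ lborel _ "{p..q}" _ f]) auto
    have "set_integrable lborel {q<..r} g"
      by (rule set_integrable_subset[OF g]) auto
    then show "set_integrable lborel {q<..r} ?F"
      by (subst set_integrable_cong[of _ lborel _ "{q<..r}" _ g]) auto
  qed auto
  moreover have "{p..q} \<union> {q<..r} = {p..r}" using assms by auto
  ultimately show ?thesis by simp
qed

lemma finite_energy_path_join:
  assumes 1: "finite_energy_path h p q u du" and 2: "finite_energy_path h q r u' du'"
    and "p \<le> q" "q \<le> r" "u q = u' q"
  shows "finite_energy_path h p r (\<lambda>x. if x \<le> q then u x else u' x)
           (\<lambda>x. if x \<le> q then du x else du' x)" (is "finite_energy_path h p r ?u ?du")
proof -
  have [measurable]: "u \<in> borel_measurable borel" "u' \<in> borel_measurable borel"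
    "du \<in> borel_measurable borel" "du' \<in> borel_measurable borel"
    by (fact finite_energy_pathD(1,2)[OF 1] finite_energy_pathD(1,2)[OF 2])+
  have [measurable]: "?u \<in> borel_measurable borel" "?du \<in> borel_measurable borel"
    by measurable
  have "(\<lambda>x. (?du x)\<^sup>2) = (\<lambda>x. if x \<le> q then (du x)\<^sup>2 else (du' x)\<^sup>2)"
    "(\<lambda>x. (h (?u x))\<^sup>2) = (\<lambda>x. if x \<le> q then (h (u x))\<^sup>2 else (h (u' x))\<^sup>2)"
    by auto
  then have sq: "set_integrable lborel {p..r} (\<lambda>x. (?du x)\<^sup>2)"
      "set_integrable lborel {p..r} (\<lambda>x. (h (?u x))\<^sup>2)"
    using set_integrable_Icc_join[OF finite_energy_pathD(3)[OF 1] finite_energy_pathD(3)[OF 2] assms(3,4)]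
      set_integrable_Icc_join[OF finite_energy_pathD(4)[OF 1] finite_energy_pathD(4)[OF 2] assms(3,4)]
    by simp_all
  have du1: "set_integrable lborel {p..r} ?du"
    by (rule set_integrable_Icc_of_square[OF _ sq(1)]) simp
  have ne: "AE x in lborel. x \<in> {p..r} \<longrightarrow> ?u x \<noteq> 0"
    using finite_energy_pathD(5)[OF 1] finite_energy_pathD(5)[OF 2] by eventually_elim auto
  have low: "?u x = ?u p + (LINT t:{p..x}|lborel. ?du t)" if "x \<in> {p..q}" for x
  proof -
    have "(LINT t:{p..x}|lborel. ?du t) = (LINT t:{p..x}|lborel. du t)"
      using that by (intro set_lebesgue_integral_cong) auto
    then show ?thesis using finite_energy_pathD(6)[OF 1 that] that by simp
  qed
  have high: "?u x = ?u p + (LINT t:{p..x}|lborel. ?du t)" if "x \<in> {q<..r}" for x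
  proof -
    have "(LINT t:{q..x}|lborel. ?du t) = (LINT t:{q..x}|lborel. du' t)"
    proof (rule set_lebesgue_integral_cong_AE)
      show "AE t\<in>{q..x} in lborel. ?du t = du' t"
        using AE_lborel_singleton[of q] by eventually_elim auto
    qed auto
    moreover have "u' x = u' q + (LINT t:{q..x}|lborel. du' t)"
      by (rule finite_energy_pathD(6)[OF 2]) (use that in auto)
    moreover have "(LINT t:{p..x}|lborel. ?du t) = (LINT t:{p..q}|lborel. ?du t) + (LINT t:{q..x}|lborel. ?du t)"
      using that assms by (intro set_integral_Icc_combine set_integrable_subset[OF du1]) auto
    ultimately show ?thesis using low[of q] that assms by simp
  qed
  show ?thesis
  proof (rule finite_energy_pathI[OF _ _ sq ne])
    fix x assume "x \<in> {p..r}"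
    then show "?u x = ?u p + (LINT t:{p..x}|lborel. ?du t)"
      using low[of x] high[of x] by (cases "x \<in> {p..q}") auto
  qed measurable
qed

section \<open>Reversal of time and of sign for paths\<close>

lemma set_integrable_Icc_reflect:
  fixes f :: "real \<Rightarrow> real"
  assumes "set_integrable lborel {p..q} f"
  shows "set_integrable lborel {c - q..c - p} (\<lambda>x. f (c - x))"
proof -
  have "integrable lborel (\<lambda>x. indicator {p..q} (c + (-1) * x) *\<^sub>R f (c + (-1) * x))"
    using assms unfolding set_integrable_def by (rule lborel_integrable_real_affine) simp
  moreover have "(\<lambda>x. indicator {p..q} (c + (-1) * x) *\<^sub>R f (c + (-1) * x))
      = (\<lambda>x. indicator {c - q..c - p} x *\<^sub>R f (c - x))"
    by (auto split: split_indicator)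
  ultimately show ?thesis by (simp add: set_integrable_def)
qed

lemma set_integral_Icc_reflect:
  fixes f :: "real \<Rightarrow> real"
  shows "(LINT x:{c - q..c - p}|lborel. f (c - x)) = (LINT x:{p..q}|lborel. f x)"
proof -
  have "(LINT x:{p..q}|lborel. f x)
      = (LINT x|lborel. indicator {p..q} (c + (-1) * x) *\<^sub>R f (c + (-1) * x))"
    unfolding set_lebesgue_integral_def
    by (subst lborel_integral_real_affine[where c="-1" and t=c]) auto
  moreover have "(\<lambda>x. indicator {p..q} (c + (-1) * x) *\<^sub>R f (c + (-1) * x))
      = (\<lambda>x. indicator {c - q..c - p} x *\<^sub>R f (c - x))"
    by (auto split: split_indicator)
  ultimately show ?thesis by (simp add: set_lebesgue_integral_def)
qed

text \<open>Finite energy is blind to the direction of travel, whereas the first-order equation is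
  not, since reversal changes the sign of u'. The reflection turns a path that leaves 0 into one
  that arrives at 0.\<close>

lemma finite_energy_path_reflect:
  assumes path: "finite_energy_path h p q u du" and "p \<le> q"
  shows "finite_energy_path h (c - q) (c - p) (\<lambda>x. u (c - x)) (\<lambda>x. - du (c - x))"
proof -
  note [measurable] = finite_energy_pathD(1,2)[OF path]
  note sq = finite_energy_pathD(3,4)[OF path]
  note ne = finite_energy_pathD(5)[OF path]
  note eq = finite_energy_pathD(6)[OF path]
  have du1: "set_integrable lborel {p..q} du"
    by (rule set_integrable_Icc_of_square[OF _ sq(1)]) simp
  have "AE x in lborel. c + (-1) * x \<in> {p..q} \<longrightarrow> u (c + (-1) * x) \<noteq> 0"
    using ne by (intro AE_borel_affine) auto
  then have ne': "AE x in lborel. x \<in> {c - q..c - p} \<longrightarrow> u (c - x) \<noteq> 0"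
    by eventually_elim auto
  have eq': "u (c - x) = u (c - (c - q)) + (LINT t:{c - q..x}|lborel. - du (c - t))"
    if "x \<in> {c - q..c - p}" for x
  proof -
    have "set_integrable lborel {c - x..q} du"
      using that by (intro set_integrable_subset[OF du1]) auto
    from set_integrable_Icc_reflect[OF this, of c]
    have "(LINT t:{c - q..x}|lborel. - du (c - t)) = - (LINT t:{c - q..c - (c - x)}|lborel. du (c - t))"
      by (simp add: set_integral_uminus)
    also have "(LINT t:{c - q..c - (c - x)}|lborel. du (c - t)) = (LINT t:{c - x..q}|lborel. du t)"
      by (rule set_integral_Icc_reflect)
    also have "\<dots> = u q - u (c - x)"
      using eq[of q] eq[of "c - x"] set_integral_Icc_combine[OF du1, of "c - x"] that \<open>p \<le> q\<close> by simp
    finally show ?thesis by simp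
  qed
  show ?thesis
    by (rule finite_energy_pathI[OF _ _ _ _ ne' eq'])
      (use set_integrable_Icc_reflect[OF sq(1), of c] set_integrable_Icc_reflect[OF sq(2), of c] in auto)
qed

text \<open>Exchanges h(s) for h(-s), so that negative target values reduce to positive
  ones.\<close>

lemma finite_energy_path_uminus:
  assumes path: "finite_energy_path (\<lambda>s. h (- s)) p q u du"
  shows "finite_energy_path h p q (\<lambda>x. - u x) (\<lambda>x. - du x)"
proof (rule finite_energy_pathI)
  note D = finite_energy_pathD[OF path]
  show "(\<lambda>x. - u x) \<in> borel_measurable borel" "(\<lambda>x. - du x) \<in> borel_measurable borel"
    using D(1,2) by simp_all
  show "set_integrable lborel {p..q} (\<lambda>x. (- du x)\<^sup>2)" "set_integrable lborel {p..q} (\<lambda>x. (h (- u x))\<^sup>2)"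
    using D(3,4) by simp_all
  show "AE x in lborel. x \<in> {p..q} \<longrightarrow> - u x \<noteq> 0" using D(5) by simp
  fix x assume x: "x \<in> {p..q}"
  have "set_integrable lborel {p..x} du"
    by (rule set_integrable_subset[OF set_integrable_Icc_of_square[OF D(2,3)]]) (use x in auto)
  then show "- u x = - u p + (LINT t:{p..x}|lborel. - du t)"
    using D(6)[OF x] by (simp add: set_integral_uminus)
qed

section \<open>Steering between 0 and a nonzero value\<close>

context singular_flux
begin

text \<open>The condition \<open>0 < s * s'\<close> says that both ends lie on the same side of 0.
  The affine path then avoids 0, so \<open>h\<close> is continuous, hence square integrable, along
  it.\<close>

lemma finite_energy_path_segment:
  assumes "p < q" "0 < s * s'"
  obtains u du where "finite_energy_path h p q u du" "u p = s" "u q = s'"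
proof -
  define c where "c = (s' - s) / (q - p)"
  define u where "u x = s + (x - p) * c" for x
  have ends: "u p = s" "u q = s'" using assms by (auto simp: u_def c_def)
  have ne: "u x \<noteq> 0" if "x \<in> {p..q}" for x
  proof -
    have *: "u x = (q - x) / (q - p) * s + (x - p) / (q - p) * s'"
    proof -
      have "(q - x) / (q - p) = 1 - (x - p) / (q - p)" using assms by (simp add: field_simps)
      then show ?thesis by (simp add: u_def c_def algebra_simps diff_divide_distrib)
    qed
    \<comment> \<open>Multiplying by \<open>s\<close> treats both signs at once; x = p is apart
      because the weight of \<open>s'\<close> vanishes there.\<close>
    have "0 < u x * s"
    proof (cases "x = p")
      case True then show ?thesis using ends assms by (auto simp: zero_less_mult_iff)
    next
      case False
      have "0 < s' * s" using assms by (simp add: mult.commute)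
      then have "0 < (x - p) / (q - p) * (s' * s)"
        using that assms \<open>x \<noteq> p\<close> by simp
      moreover have "0 \<le> (q - x) / (q - p) * (s * s)"
        using that assms by simp
      ultimately show ?thesis by (simp add: * algebra_simps)
    qed
    then show ?thesis by auto
  qed
  have cont_u: "continuous_on A u" for A unfolding u_def by (intro continuous_intros)
  have [measurable]: "u \<in> borel_measurable borel"
    by (rule borel_measurable_continuous_onI[OF cont_u])
  have hu2: "set_integrable lborel {p..q} (\<lambda>x. (h (u x))\<^sup>2)"
    unfolding set_integrable_def
  proof (rule borel_integrable_compact)
    have "continuous_on {p..q} (\<lambda>x. h (u x))"
      by (rule continuous_on_compose2[OF cont cont_u]) (use ne in auto)
    then show "continuous_on {p..q} (\<lambda>x. (h (u x))\<^sup>2)" by (intro continuous_intros)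
  qed auto
  have c2: "set_integrable lborel {p..q} (\<lambda>x. c\<^sup>2)"
    by (rule set_integrable_Icc_bounded[where C="c\<^sup>2"]) auto
  have "finite_energy_path h p q u (\<lambda>x. c)"
  proof (rule finite_energy_pathI[where h=h and u=u and du="\<lambda>x. c", OF _ _ c2 hu2])
    show "u x = u p + (LINT t:{p..x}|lborel. c)" if "x \<in> {p..q}" for x
      using that by (simp add: set_integral_Icc_const u_def)
  qed (use ne in auto)
  then show thesis using that ends by blast
qed

text \<open>Adding the forcing \<open>m + 1\<close> makes the right-hand side at least \<open>1\<close>, so the solution
  starting at \<open>0\<close> becomes positive immediately.\<close>
lemma finite_energy_path_from_0_pos:
  assumes "0 < p" "0 < s"
  obtains u du where "finite_energy_path h 0 p u du" "u 0 = 0" "u p = s"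
proof -
  have c: "set_integrable lborel {0..x} (\<lambda>t. c)" for x c :: real
    by (rule set_integrable_Icc_bounded[where C="\<bar>c\<bar>"]) auto
  \<comment> \<open>Only the first half of the interval is spent on leaving 0. The value reached at
    p/2 is some positive number, and a segment over the second half carries it to
    \<open>s\<close>.\<close>
  obtain v where cont_v: "continuous_on UNIV v"
    and ne: "AE x in lborel. x \<in> {0..p/2} \<longrightarrow> v x \<noteq> 0"
    and hv: "set_integrable lborel {0..p/2} (\<lambda>t. (h (v t))\<^sup>2)"
    and dv: "set_integrable lborel {0..p/2} (\<lambda>t. (1 * (h (v t) + (m + 1)))\<^sup>2)"
    and v: "\<And>x. x \<in> {0..p/2} \<Longrightarrow> v x = (LINT t:{0..x}|lborel. 1 * (h (v t) + (m + 1)))"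
    using singular_initial_value_problem[of "p/2" 1 "\<lambda>t. 1" "\<lambda>t. m + 1" 1] assms(1) c by auto
  have [measurable]: "v \<in> borel_measurable borel" by (rule borel_measurable_continuous_onI[OF cont_v])
  define dv where "dv t = h (v t) + (m + 1)" for t
  have [measurable]: "dv \<in> borel_measurable borel" unfolding dv_def by measurable
  have dv2: "set_integrable lborel {0..p/2} (\<lambda>t. (dv t)\<^sup>2)" using dv by (simp add: dv_def)
  have dv1: "set_integrable lborel {0..p/2} dv" by (rule set_integrable_Icc_of_square[OF _ dv2]) simp
  have v': "v x = (LINT t:{0..x}|lborel. dv t)" if "x \<in> {0..p/2}" for x
    using v[OF that] by (simp add: dv_def)
  have "v 0 = 0"
    using v'[of 0] set_integral_Icc_combine[OF set_integrable_subset[OF dv1], of 0 0 0] assms by simp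
  have "(LINT t:{0..p/2}|lborel. 1) \<le> (LINT t:{0..p/2}|lborel. dv t)"
  proof (rule set_integral_mono[OF c dv1])
    show "1 \<le> dv t" for t using below[of "v t"] by (simp add: dv_def)
  qed
  then have "0 < v (p/2)" using v'[of "p/2"] assms(1) by (simp add: set_integral_Icc_const)
  then obtain w dw where w: "finite_energy_path h (p/2) p w dw" "w (p/2) = v (p/2)" "w p = s"
    using finite_energy_path_segment[of "p/2" p "v (p/2)" s] assms by auto
  have "finite_energy_path h 0 (p/2) v dv"
    by (rule finite_energy_pathI[OF _ _ dv2 hv ne]) (use v' \<open>v 0 = 0\<close> in simp_all)
  from finite_energy_path_join[OF this w(1)] show thesis
    using that w assms \<open>v 0 = 0\<close> by auto
qed

lemma singular_flux_reflect: "singular_flux (\<lambda>s. h (- s)) (\<lambda>s. k (- s)) m M"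
proof
  show "continuous_on (- {0}) (\<lambda>s. h (- s))"
    by (rule continuous_on_compose2[OF cont]) (auto intro!: continuous_intros)
  have "filterlim uminus (at 0) (at (0::real))"
    unfolding filterlim_at by (auto simp: eventually_at intro!: tendsto_eq_intros exI[of _ 1])
  then show "filterlim (\<lambda>s. h (- s)) at_top (at 0)"
    by (rule filterlim_compose[OF blowup])
  show "integrable lborel (\<lambda>s. k (- s))"
    using lborel_integrable_real_affine[OF k_integrable, of "-1" 0] by simp
qed (use below growth k_nonneg in auto)

text \<open>The target will be a value of the given trajectory after L - \<delta>, whose sign is
  unknown; negative targets come from the flux h(-s).\<close>

lemma finite_energy_path_from_0:
  assumes "0 < p" "s \<noteq> 0"
  obtains u du where "finite_energy_path h 0 p u du" "u 0 = 0" "u p = s"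
proof (cases "0 < s")
  case True
  then show ?thesis using finite_energy_path_from_0_pos assms that by blast
next
  case False
  interpret reflect: singular_flux "\<lambda>s. h (- s)" "\<lambda>s. k (- s)" m M
    by (rule singular_flux_reflect)
  have "0 < - s" using False assms by simp
  then obtain u du where "finite_energy_path (\<lambda>s. h (- s)) 0 p u du" "u 0 = 0" "u p = - s"
    using reflect.finite_energy_path_from_0_pos[OF assms(1)] by metis
  then show ?thesis using that[of "\<lambda>x. - u x" "\<lambda>x. - du x"] finite_energy_path_uminus by auto
qed

theorem controlled_trajectory:
  fixes b g :: "real \<Rightarrow> real"
  assumes "0 < \<alpha>" and [measurable]: "b \<in> borel_measurable borel" "g \<in> borel_measurable borel"
    and b: "\<And>t. 0 < b t" "\<And>t. \<alpha> * b t \<le> 1" "\<And>t. 1 \<le> \<beta> * b t"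
    and g: "set_integrable lborel {0..L} (\<lambda>t. (g t)\<^sup>2)" and "0 < \<delta>" "\<delta> < L"
  obtains u du where "finite_energy_path h 0 L u du" "u 0 = 0" "u L = 0"
    "\<And>x. x \<in> {0..L - \<delta>} \<Longrightarrow> du x = b x * (h (u x) + g x)"
proof -
  \<comment> \<open>Half of \<delta> leaves an open interval between L - \<delta> and T in which to
    find a nonzero value, and a positive length up to L for the return to 0.\<close>
  define T where "T = L - \<delta> / 2"
  have "0 < T" "L - \<delta> < T" "T < L" using assms by (auto simp: T_def)
  have gT: "set_integrable lborel {0..T} (\<lambda>t. (g t)\<^sup>2)"
    by (rule set_integrable_subset[OF g]) (use \<open>T < L\<close> in auto)
  obtain v where cont_v: "continuous_on UNIV v"
    and ne: "AE x in lborel. x \<in> {0..T} \<longrightarrow> v x \<noteq> 0"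
    and hv: "set_integrable lborel {0..T} (\<lambda>t. (h (v t))\<^sup>2)"
    and dv: "set_integrable lborel {0..T} (\<lambda>t. (b t * (h (v t) + g t))\<^sup>2)"
    and v: "\<And>x. x \<in> {0..T} \<Longrightarrow> v x = (LINT t:{0..x}|lborel. b t * (h (v t) + g t))"
    by (rule singular_initial_value_problem[OF \<open>0 < T\<close> \<open>0 < \<alpha>\<close> \<open>b \<in> _\<close> \<open>g \<in> _\<close> b gT]) auto
  have [measurable]: "v \<in> borel_measurable borel" by (rule borel_measurable_continuous_onI[OF cont_v])
  define dv where "dv t = b t * (h (v t) + g t)" for t
  have [measurable]: "dv \<in> borel_measurable borel" unfolding dv_def by measurable
  have dv2: "set_integrable lborel {0..T} (\<lambda>t. (dv t)\<^sup>2)" using dv by (simp add: dv_def)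
  have dv1: "set_integrable lborel {0..T} dv" by (rule set_integrable_Icc_of_square[OF _ dv2]) simp
  have v': "v x = (LINT t:{0..x}|lborel. dv t)" if "x \<in> {0..T}" for x
    using v[OF that] by (simp add: dv_def)
  have "v 0 = 0"
    using v'[of 0] set_integral_Icc_combine[OF set_integrable_subset[OF dv1], of 0 0 0] \<open>0 < T\<close> by simp
  \<comment> \<open>The zero set of \<open>v\<close> in [0, T] is null, so it cannot contain an
    interval of positive length.\<close>
  have "\<exists>q. L - \<delta> < q \<and> q < T \<and> v q \<noteq> 0"
  proof (rule ccontr)
    assume "\<not> ?thesis"
    then have "v x = 0" if "x \<in> {L - \<delta><..<T}" for x using that by auto
    with \<open>\<delta> < L\<close> have imp: "x \<notin> {L - \<delta><..<T}" if "x \<in> {0..T} \<longrightarrow> v x \<noteq> 0" for x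
      using that by force
    have "AE x in lborel. x \<notin> {L - \<delta><..<T}"
      by (rule AE_mp[OF ne]) (use imp in auto)
    then have "{L - \<delta><..<T} \<in> null_sets lborel" by (subst AE_iff_null_sets) auto
    then show False using \<open>L - \<delta> < T\<close> by (auto simp: null_sets_def)
  qed
  then obtain q where q: "L - \<delta> < q" "q < T" "v q \<noteq> 0" by blast
  have sub: "set_integrable lborel {0..q} F" if "set_integrable lborel {0..T} F" for F :: "real \<Rightarrow> real"
    by (rule set_integrable_subset[OF that]) (use q in auto)
  have ne_q: "AE x in lborel. x \<in> {0..q} \<longrightarrow> v x \<noteq> 0"
    using ne by eventually_elim (use q in auto)
  have 1: "finite_energy_path h 0 q v dv"
    by (rule finite_energy_pathI[OF _ _ sub[OF dv2] sub[OF hv] ne_q]) (use v' q \<open>v 0 = 0\<close> in simp_all)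
  have "0 < L - q" using q \<open>T < L\<close> by simp
  \<comment> \<open>Built from the end: \<open>w\<close> leaves 0 and reaches \<open>v q\<close> in
    time L - q, and the substitution of L - x for x makes it start at \<open>v q\<close> and end at
    0.\<close>
  then obtain w dw where w: "finite_energy_path h 0 (L - q) w dw" "w 0 = 0" "w (L - q) = v q"
    using finite_energy_path_from_0 q(3) by metis
  have "finite_energy_path h q L (\<lambda>x. w (L - x)) (\<lambda>x. - dw (L - x))"
    using finite_energy_path_reflect[OF w(1), of L] \<open>0 < L - q\<close> by simp
  from finite_energy_path_join[OF 1 this]
  have "finite_energy_path h 0 L (\<lambda>x. if x \<le> q then v x else w (L - x))
      (\<lambda>x. if x \<le> q then dv x else - dw (L - x))"
    using w q \<open>0 < L - q\<close> \<open>\<delta> < L\<close> by simp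
  then show thesis
    by (rule that) (use q \<open>T < L\<close> \<open>\<delta> < L\<close> \<open>v 0 = 0\<close> w in \<open>auto simp: dv_def\<close>)
qed

end

section \<open>From the extended-valued nonlinearity to the weak solution\<close>

lemma singular_flux_of_ereal:
  assumes phi: "H_phi phi" "phi 0 = \<infinity>" "H_int phi" "H_bdd phi"
  shows "\<exists>k m M. singular_flux (\<lambda>s. real_of_ereal (phi s)) k m M"
proof -
  define h where "h s = real_of_ereal (phi s)" for s
  have h: "phi s = ereal (h s)" if "s \<noteq> 0" for s
  proof -
    have "phi s < \<infinity>" "phi s \<noteq> - \<infinity>" using phi(1) that unfolding H_phi_def by blast+
    then show ?thesis unfolding h_def by (cases "phi s") auto
  qed
  have cont_phi: "continuous_on UNIV phi" using phi(1) by (simp add: H_phi_def)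
  have cont: "continuous_on (- {0}) h"
  proof -
    have "continuous_on (- {0}) (real_of_ereal \<circ> phi)"
    proof (rule continuous_on_compose)
      show "continuous_on (- {0}) phi" by (rule continuous_on_subset[OF cont_phi]) simp
      show "continuous_on (phi ` (- {0})) real_of_ereal"
        by (rule continuous_on_subset[OF continuous_on_real]) (auto simp: h)
    qed
    then show ?thesis by (simp add: h_def[abs_def] comp_def)
  qed
  have blowup: "filterlim h at_top (at 0)"
    unfolding filterlim_at_top
  proof
    fix C
    have "(phi \<longlongrightarrow> \<infinity>) (at 0)"
      using cont_phi phi(2) by (metis UNIV_I continuous_on_def)
    then have "\<forall>\<^sub>F t in at 0. ereal C < phi t" by (rule order_tendstoD) simp
    moreover have "\<forall>\<^sub>F t in at (0::real). t \<noteq> 0" by (simp add: eventually_at_filter)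
    ultimately show "\<forall>\<^sub>F t in at 0. C \<le> h t" by eventually_elim (simp add: h)
  qed
  have bdd: "\<exists>M. \<forall>s. r \<le> \<bar>s\<bar> \<longrightarrow> \<bar>h s\<bar> \<le> M" if "r > 0" for r
    using phi(4) that unfolding H_bdd_def h_def by blast
  \<comment> \<open>The blow-up makes \<open>h\<close> nonnegative near 0, and (H_bdd) covers the
    rest; together they give the lower bound -m.\<close>
  obtain r where "r > 0" and r: "\<And>t. t \<noteq> 0 \<Longrightarrow> \<bar>t\<bar> < r \<Longrightarrow> 0 \<le> h t"
    using blowup unfolding filterlim_at_top eventually_at by (force simp: dist_real_def)
  obtain m where m: "\<And>s. r \<le> \<bar>s\<bar> \<Longrightarrow> \<bar>h s\<bar> \<le> m" using bdd[OF \<open>r > 0\<close>] by blast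
  obtain M where M: "\<And>s. 1/2 \<le> \<bar>s\<bar> \<Longrightarrow> \<bar>h s\<bar> \<le> M" using bdd[of "1/2"] by auto
  \<comment> \<open>\<open>real_of_ereal\<close> sends infinity to 0, so the junk value satisfies
    the bounds that are required at every point.\<close>
  have h0: "h 0 = 0" using phi(2) by (simp add: h_def)
  have "0 \<le> m" using m[of r] \<open>r > 0\<close> by linarith
  have "0 \<le> M" using M[of 1] by linarith
  \<comment> \<open>Cutting at 1/2 stays inside the range (0, 1) in which (H_int) gives
    integrability; \<open>M\<close> was taken for |s| \<ge> 1/2.\<close>
  define k where "k s = indicator {-1/2<..<0} s *\<^sub>R \<bar>h s\<bar> + indicator {0<..<1/2} s *\<^sub>R \<bar>h s\<bar>" for s
  have "singular_flux h k m M"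
  proof
    show "- m \<le> h s" for s
      using r[of s] m[of s] \<open>0 \<le> m\<close> h0 by (cases "s = 0"; cases "\<bar>s\<bar> < r") auto
    have "set_integrable lborel {0<..<1/2} h" "set_integrable lborel {- (1/2)<..<0} h"
      using phi(3) unfolding H_int_def h_def[abs_def] by (metis half_gt_zero zero_less_one field_sum_of_halves less_add_same_cancel1)+
    from this[THEN set_integrable_abs] show "integrable lborel k"
      unfolding k_def[abs_def] set_integrable_def by (intro Bochner_Integration.integrable_add) auto
    show "0 \<le> k s" for s by (simp add: k_def)
    show "\<bar>h s\<bar> \<le> k s + M" for s
    proof (cases "1/2 \<le> \<bar>s\<bar>")
      case True
      then show ?thesis using M[of s] by (simp add: k_def add_increasing)
    next
      case False
      then show ?thesis using \<open>0 \<le> M\<close> h0 by (cases "s = 0") (auto simp: k_def indicator_def abs_if split: if_splits)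
    qed
  qed (fact cont blowup)+
  then show ?thesis unfolding h_def by blast
qed

lemma test_fun_deriv:
  assumes "test_fun L \<psi>"
  shows "continuous_on UNIV (deriv \<psi>)"
proof -
  have "((deriv ^^ 1) \<psi>) differentiable (at x)" for x
    using assms unfolding test_fun_def by blast
  then show ?thesis by (intro differentiable_imp_continuous_on) (simp add: differentiable_on_def differentiable_at_withinI)
qed

theorem mainTheorem15:
  fixes L :: real and a g :: "real \<Rightarrow> real" and phi :: "real \<Rightarrow> ereal" and \<delta> :: real
  assumes "L > 0"
    and "H_a L a"
    and "H_phi phi" and "phi 0 = \<infinity>" and "H_int phi" and "H_bdd phi"
    and "L2_on L g"
    and "0 < \<delta>" and "\<delta> < L"
  shows "\<exists>gh. L2_on L gh \<and>
           (AE x in lborel. x \<in> {0..L - \<delta>} \<longrightarrow> gh x = g x) \<and>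
           (\<exists>u. weak_solution L a gh phi u)"
proof -
  define h where "h s = real_of_ereal (phi s)" for s
  obtain k m M where "singular_flux h k m M"
    using singular_flux_of_ereal assms(3-6) unfolding h_def by blast
  then interpret singular_flux h k m M .
  obtain \<alpha> \<beta> where \<alpha>\<beta>: "0 < \<alpha>" "\<alpha> < \<beta>"
    and ab: "AE x in lborel. x \<in> {0<..<L} \<longrightarrow> \<alpha> \<le> a x \<and> a x \<le> \<beta>"
    using \<open>H_a L a\<close> unfolding H_a_def by blast
  define a1 where "a1 x = indicator {0<..<L} x *\<^sub>R a x" for x
  define g1 where "g1 x = indicator {0<..<L} x *\<^sub>R g x" for x
  \<comment> \<open>Truncation to [\<alpha>, \<beta>] makes the bounds hold at every point, as the
    trajectory theorem demands, and changes the coefficient only on a null subset of (0, L).\<close>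
  define A where "A x = max \<alpha> (min \<beta> (a1 x))" for x
  have [measurable]: "a1 \<in> borel_measurable borel" "g1 \<in> borel_measurable borel"
    using \<open>H_a L a\<close> \<open>L2_on L g\<close>
    by (auto simp: H_a_def L2_on_def set_borel_measurable_def a1_def[abs_def] g1_def[abs_def])
  have [measurable]: "A \<in> borel_measurable borel" unfolding A_def by measurable
  have A: "\<alpha> \<le> A x" "A x \<le> \<beta>" "0 < A x" for x using \<alpha>\<beta> by (auto simp: A_def)
  have A_eq: "AE x in lborel. x \<in> {0<..<L} \<longrightarrow> a1 x = A x"
    using ab by eventually_elim (auto simp: A_def a1_def)
  have "integrable lborel (\<lambda>x. indicator {0<..<L} x *\<^sub>R (g x)\<^sup>2)"
    using \<open>L2_on L g\<close> by (simp add: L2_on_def set_integrable_def)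
  moreover have "(\<lambda>x. indicator {0<..<L} x *\<^sub>R (g x)\<^sup>2) = (\<lambda>x. indicator {0..L} x *\<^sub>R (g1 x)\<^sup>2)"
    by (auto simp: g1_def indicator_def)
  ultimately have g1: "set_integrable lborel {0..L} (\<lambda>x. (g1 x)\<^sup>2)"
    by (simp add: set_integrable_def)
  obtain u du where path: "finite_energy_path h 0 L u du" and ends: "u 0 = 0" "u L = 0"
    and du_eq: "\<And>x. x \<in> {0..L - \<delta>} \<Longrightarrow> du x = 1 / A x * (h (u x) + g1 x)"
  proof (rule controlled_trajectory[of \<alpha> "\<lambda>x. 1 / A x" g1 \<beta> L \<delta>])
    show "0 < 1 / A t" "\<alpha> * (1 / A t) \<le> 1" "1 \<le> \<beta> * (1 / A t)" for t
      using A[of t] by (auto simp: divide_simps)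
  qed (use \<alpha>\<beta> g1 \<open>0 < \<delta>\<close> \<open>\<delta> < L\<close> in auto)
  note [measurable] = finite_energy_pathD(1,2)[OF path]
  note du2 = finite_energy_pathD(3)[OF path]
  note hu2 = finite_energy_pathD(4)[OF path]
  note ne = finite_energy_pathD(5)[OF path]
  have u: "u x = (LINT t:{0..x}|lborel. du t)" if "x \<in> {0..L}" for x
    using finite_energy_pathD(6)[OF path that] ends by simp
  \<comment> \<open>On the steering part this defines the new forcing; on [0, L - \<delta>] it
    reproduces \<open>g1\<close>, because the path solves the equation there.\<close>
  define gh where "gh x = A x * du x - h (u x)" for x
  have [measurable]: "gh \<in> borel_measurable borel" unfolding gh_def by measurable
  have Adu2: "set_integrable lborel {0..L} (\<lambda>x. (A x * du x)\<^sup>2)"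
  proof (rule set_integrable_bound[where f="\<lambda>x. \<beta>\<^sup>2 * (du x)\<^sup>2"])
    show "set_integrable lborel {0..L} (\<lambda>x. \<beta>\<^sup>2 * (du x)\<^sup>2)" using du2 by simp
    show "set_borel_measurable lborel {0..L} (\<lambda>x. (A x * du x)\<^sup>2)"
      by (simp add: set_borel_measurable_def)
    have "(A x)\<^sup>2 \<le> \<beta>\<^sup>2" for x using A[of x] by (intro power_mono) auto
    then show "AE x in lborel. x \<in> {0..L} \<longrightarrow> norm ((A x * du x)\<^sup>2) \<le> norm (\<beta>\<^sup>2 * (du x)\<^sup>2)"
      by (auto simp: power_mult_distrib intro!: mult_right_mono)
  qed
  have gh2: "set_integrable lborel {0..L} (\<lambda>x. (gh x)\<^sup>2)"
    using set_integrable_square_add[of "\<lambda>x. A x * du x" "\<lambda>x. - h (u x)" "{0..L}"] Adu2 hu2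
    by (simp add: gh_def)
  have L2: "L2_on L F" if [measurable]: "F \<in> borel_measurable borel"
    and "set_integrable lborel {0..L} (\<lambda>x. (F x)\<^sup>2)" for F
    unfolding L2_on_def
  proof
    show "set_integrable lborel {0<..<L} (\<lambda>x. (F x)\<^sup>2)"
      by (rule set_integrable_subset[OF that(2)]) auto
  qed (simp add: set_borel_measurable_def)
  have "AE x in lborel. x \<in> {0..L - \<delta>} \<longrightarrow> gh x = g x"
    \<comment> \<open>At 0 the extension \<open>g1\<close> is 0 whatever \<open>g 0\<close>
      is.\<close>
    using AE_lborel_singleton[of 0]
  proof eventually_elim
    case (elim x)
    show ?case
    proof
      assume x: "x \<in> {0..L - \<delta>}"
      then have "x \<in> {0<..<L}" using elim \<open>0 < \<delta>\<close> by auto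
      then have "g1 x = g x" by (simp add: g1_def)
      then show "gh x = g x" using du_eq[OF x] A(3)[of x] by (simp add: gh_def)
    qed
  qed
  moreover have "weak_solution L a gh phi u"
    unfolding weak_solution_def
  proof (intro exI[of _ du] conjI allI impI)
    show "H10_deriv L u du"
      unfolding H10_deriv_def using L2[OF _ du2] u[of L] ends \<open>L > 0\<close> by (auto intro!: u)
    show "AE x in lborel. x \<in> {0<..<L} \<longrightarrow> phi (u x) \<noteq> \<infinity>"
      using ne by eventually_elim (use \<open>H_phi phi\<close> in \<open>force simp: H_phi_def\<close>)
    show "L2_on L (\<lambda>x. real_of_ereal (phi (u x)))"
      using L2[OF _ hu2] unfolding h_def[symmetric] by simp
    fix \<psi> assume "test_fun L \<psi>"
    then have cont_\<psi>: "continuous_on UNIV (deriv \<psi>)" by (rule test_fun_deriv)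
    then have [measurable]: "deriv \<psi> \<in> borel_measurable borel"
      by (rule borel_measurable_continuous_onI)
    obtain C where C: "\<And>x. x \<in> {0..L} \<Longrightarrow> \<bar>deriv \<psi> x\<bar> \<le> C"
      using compact_imp_bounded[OF compact_continuous_image[OF continuous_on_subset[OF cont_\<psi>] compact_Icc], of 0 L]
      unfolding bounded_iff by (metis imageI real_norm_def subset_UNIV)
    have int: "set_integrable lborel {0<..<L} (\<lambda>x. F x * deriv \<psi> x)"
      if [measurable]: "F \<in> borel_measurable borel"
      and F: "set_integrable lborel {0..L} (\<lambda>x. (F x)\<^sup>2)" for F
    proof (rule set_integrable_subset)
      show "set_integrable lborel {0..L} (\<lambda>x. F x * deriv \<psi> x)"
      proof (rule set_integrable_bound[where f="\<lambda>x. F x * C"])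
        show "set_integrable lborel {0..L} (\<lambda>x. F x * C)"
          using set_integrable_Icc_of_square[OF _ F] by simp
        show "set_borel_measurable lborel {0..L} (\<lambda>x. F x * deriv \<psi> x)"
          by (simp add: set_borel_measurable_def)
        show "AE x in lborel. x \<in> {0..L} \<longrightarrow> norm (F x * deriv \<psi> x) \<le> norm (F x * C)"
          using C by (fastforce simp: abs_mult intro!: mult_left_mono AE_I2)
      qed
    qed auto
    have "(LINT x:{0<..<L}|lborel. a x * du x * deriv \<psi> x)
        = (LINT x:{0<..<L}|lborel. a1 x * du x * deriv \<psi> x)"
      by (rule set_lebesgue_integral_cong) (auto simp: a1_def)
    \<comment> \<open>By the choice of \<open>gh\<close>, A u' = h(u) + gh holds pointwise, so the
      weak identity is this equation multiplied by the derivative of the test function; no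
      integration by parts occurs.\<close>
    also have "\<dots> = (LINT x:{0<..<L}|lborel. h (u x) * deriv \<psi> x + gh x * deriv \<psi> x)"
    proof (rule set_lebesgue_integral_cong_AE)
      show "AE x\<in>{0<..<L} in lborel. a1 x * du x * deriv \<psi> x = h (u x) * deriv \<psi> x + gh x * deriv \<psi> x"
        using A_eq by eventually_elim (auto simp: gh_def algebra_simps)
    qed auto
    also have "\<dots> = (LINT x:{0<..<L}|lborel. h (u x) * deriv \<psi> x) + (LINT x:{0<..<L}|lborel. gh x * deriv \<psi> x)"
      using int[OF _ hu2] int[OF _ gh2] by simp
    finally show "(LINT x:{0<..<L}|lborel. a x * du x * deriv \<psi> x) =
        (LINT x:{0<..<L}|lborel. real_of_ereal (phi (u x)) * deriv \<psi> x) +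
        (LINT x:{0<..<L}|lborel. gh x * deriv \<psi> x)"
      by (simp add: h_def)
  qed
  ultimately show ?thesis using L2[OF _ gh2] by auto
qed

end
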